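(* There is a polynomial-time 2-approximation algorithm for \textsc{min-avg} RFTT on instances in which $G$ is a tree; i.e. it outputs (a compact description of) a feasible solution whose average tour length is at most $2\,OPT(G,\tau)$.
   Context: RFTT: an instance is $(G,\tau)$ with $G=(V\cup\{s\},E,c)$ a connected graph with depot $s$, nonnegative edge weights $c$, clients $V=\{v_1,\dots,v_n\}$ and turnover times $\tau\in\mathbb{N}^n$. A solution gives for each day $k\ge1$ a closed walk $T_k$ in $G$ from $s$ to $s$ and a set $J_k\subseteq V$ of clients on $T_k$ visited that day; it is feasible if for all $t\ge0$ and all $j$, $v_j\in\bigcup_{k=t+1}^{t+\tau_j}J_k$; solutions are periodic with some period $\ell$. \textsc{min-avg} minimizes the average tour length $\frac1\ell\sum_{k=1}^\ell c(T_k)$, where $c(T_k)$ is the total edge weight of $T_k$ with multiplicity; $OPT(G,\tau)$ is the optimal value. *)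

theory Defs
  imports "Graph_Theory.Graph_Theory" "HOL-Computational_Algebra.Polynomial"
begin

section \<open>Recurring visits with fixed turnover times\<close>

text \<open>Undirected graphs are symmetric loop-free digraphs (\<^locale>\<open>pair_graph\<close>), tours are closed
  arc walks, and the weight of an edge is carried by both of its arcs.\<close>

locale rftt = pair_graph G for G :: "'a pair_pre_digraph" +
  fixes s :: 'a and c :: "('a \<times> 'a) weight_fun" and \<tau> :: "'a \<Rightarrow> nat"
  assumes conn: "Digraph_Component.connected (with_proj G)"
    and depot: "s \<in> pverts G"
    and weight_sym: "(u, v) \<in> parcs G \<Longrightarrow> c (u, v) = c (v, u)"
    and weight_nonneg: "e \<in> parcs G \<Longrightarrow> 0 \<le> c e"
    and turnover_pos: "v \<in> pverts G - {s} \<Longrightarrow> 1 \<le> \<tau> v"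
begin

definition clients :: "'a set" where
  "clients = pverts G - {s}"

definition feasible :: "(nat \<Rightarrow> ('a \<times> 'a) awalk) \<Rightarrow> (nat \<Rightarrow> 'a set) \<Rightarrow> bool" where
  "feasible T J \<longleftrightarrow>
     (\<forall>k\<ge>1. awalk s (T k) s \<and> J k \<subseteq> clients \<and> J k \<subseteq> set (awalk_verts s (T k))) \<and>
     (\<forall>t. \<forall>v\<in>clients. v \<in> (\<Union>k\<in>{t+1..t+\<tau> v}. J k))"

definition periodic :: "nat \<Rightarrow> (nat \<Rightarrow> ('a \<times> 'a) awalk) \<Rightarrow> (nat \<Rightarrow> 'a set) \<Rightarrow> bool" where
  "periodic l T J \<longleftrightarrow> 1 \<le> l \<and> (\<forall>k\<ge>1. T (k + l) = T k \<and> J (k + l) = J k)"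

definition avg_length :: "nat \<Rightarrow> (nat \<Rightarrow> ('a \<times> 'a) awalk) \<Rightarrow> real" where
  "avg_length l T = (\<Sum>k=1..l. awalk_cost c (T k)) / real l"

definition OPT :: real where
  "OPT = Inf {avg_length l T | l T J. feasible T J \<and> periodic l T J}"

end

text \<open>In a symmetric digraph every edge gives a \<^const>\<open>pre_digraph.cycle\<close> of length 2, so
  the library's notions of forest and tree do not describe undirected trees here; only cycles of
  length at least 3 are cycles of the undirected graph.\<close>

locale rftt_tree = rftt +
  assumes acyclic: "\<not> (\<exists>p. cycle p \<and> 3 \<le> length p)"


section \<open>Model of computation\<close>

text \<open>A first-order, call-by-value functional language on binary trees. Variables are de Bruijn
  indices; \<open>ECase e e1 e2\<close> evaluates \<open>e2\<close> with the two subtrees bound to the indices 0 (left) and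
  1 (right); a program is the list of its function bodies, of which the first is the main function.

  Reading a variable costs the size of the value read, as if the value were copied, and every other
  construct costs one step. Hence no value is larger than the time spent on computing it, and
  the model is polynomially equivalent to Turing machines.\<close>

datatype val = Leaf | Node val val

datatype exp =
    EVar nat
  | ELeaf
  | ENode exp exp
  | ECase exp exp exp
  | ELet exp exp
  | ECall nat "exp list"

type_synonym prog = "exp list"

inductive eval :: "prog \<Rightarrow> val list \<Rightarrow> exp \<Rightarrow> val \<Rightarrow> nat \<Rightarrow> bool"
  and evals :: "prog \<Rightarrow> val list \<Rightarrow> exp list \<Rightarrow> val list \<Rightarrow> nat \<Rightarrow> bool"
  for P :: prog where
  eval_Var: "i < length \<rho> \<Longrightarrow> eval P \<rho> (EVar i) (\<rho> ! i) (size (\<rho> ! i) + 1)"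
| eval_Leaf: "eval P \<rho> ELeaf Leaf 1"
| eval_Node: "eval P \<rho> e1 v1 t1 \<Longrightarrow> eval P \<rho> e2 v2 t2 \<Longrightarrow>
    eval P \<rho> (ENode e1 e2) (Node v1 v2) (t1 + t2 + 1)"
| eval_Case_Leaf: "eval P \<rho> e Leaf t1 \<Longrightarrow> eval P \<rho> e1 v t2 \<Longrightarrow>
    eval P \<rho> (ECase e e1 e2) v (t1 + t2 + 1)"
| eval_Case_Node: "eval P \<rho> e (Node a b) t1 \<Longrightarrow> eval P (a # b # \<rho>) e2 v t2 \<Longrightarrow>
    eval P \<rho> (ECase e e1 e2) v (t1 + t2 + 1)"
| eval_Let: "eval P \<rho> e1 v1 t1 \<Longrightarrow> eval P (v1 # \<rho>) e2 v t2 \<Longrightarrow>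
    eval P \<rho> (ELet e1 e2) v (t1 + t2 + 1)"
| eval_Call: "evals P \<rho> es vs t1 \<Longrightarrow> f < length P \<Longrightarrow> eval P vs (P ! f) v t2 \<Longrightarrow>
    eval P \<rho> (ECall f es) v (t1 + t2 + 1)"
| evals_Nil: "evals P \<rho> [] [] 0"
| evals_Cons: "eval P \<rho> e v t1 \<Longrightarrow> evals P \<rho> es vs t2 \<Longrightarrow>
    evals P \<rho> (e # es) (v # vs) (t1 + t2)"

definition runs :: "prog \<Rightarrow> val \<Rightarrow> val \<Rightarrow> nat \<Rightarrow> bool" where
  "runs P x y t \<longleftrightarrow> eval P [x] (ECall 0 [EVar 0]) y t"

inductive_cases eval_elims:
  "eval P \<rho> (EVar i) v t"
  "eval P \<rho> ELeaf v t"
  "eval P \<rho> (ENode e1 e2) v t"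
  "eval P \<rho> (ECase e e1 e2) v t"
  "eval P \<rho> (ELet e1 e2) v t"
  "eval P \<rho> (ECall f es) v t"
  "evals P \<rho> [] vs t"
  "evals P \<rho> (e # es) vs t"

lemma eval_deterministic:
  "eval P \<rho> e v t \<Longrightarrow> (\<forall>v' t'. eval P \<rho> e v' t' \<longrightarrow> v' = v \<and> t' = t)"
  "evals P \<rho> es vs u \<Longrightarrow> (\<forall>vs' u'. evals P \<rho> es vs' u' \<longrightarrow> vs' = vs \<and> u' = u)"
proof (induction rule: eval_evals.inducts)
  case (eval_Var i \<rho>)
  then show ?case by (auto elim: eval_elims)
next
  case (eval_Leaf \<rho>)
  then show ?case by (auto elim: eval_elims)
next
  case (eval_Node \<rho> e1 v1 t1 e2 v2 t2)
  show ?case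
    by (intro allI impI, erule eval_elims) (metis eval_Node.IH Suc_eq_plus1)
next
  case (eval_Case_Leaf \<rho> e t1 e1 v t2 e2)
  show ?case
    by (intro allI impI, erule eval_elims) (metis eval_Case_Leaf.IH val.distinct(1) Suc_eq_plus1)+
next
  case (eval_Case_Node \<rho> e a b t1 e2 v t2 e1)
  show ?case
    by (intro allI impI, erule eval_elims) (metis eval_Case_Node.IH val.distinct(1) val.inject Suc_eq_plus1)+
next
  case (eval_Let \<rho> e1 v1 t1 e2 v t2)
  show ?case
    by (intro allI impI, erule eval_elims) (metis eval_Let.IH Suc_eq_plus1)
next
  case (eval_Call \<rho> es vs t1 f v t2)
  show ?case
    by (intro allI impI, erule eval_elims) (metis eval_Call.IH Suc_eq_plus1)
next
  case (evals_Nil \<rho>)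
  then show ?case by (auto elim: eval_elims)
next
  case (evals_Cons \<rho> e v t1 es vs t2)
  show ?case
    by (intro allI impI, erule eval_elims) (metis evals_Cons.IH Suc_eq_plus1)
qed

lemma eval_size:
  "eval P \<rho> e v t \<Longrightarrow> size v \<le> t"
  "evals P \<rho> es vs u \<Longrightarrow> sum_list (map size vs) \<le> u"
  by (induction rule: eval_evals.inducts) auto


section \<open>Encodings\<close>

text \<open>Natural numbers are in binary, least significant bit first.\<close>

fun enc_nat :: "nat \<Rightarrow> val" where
  "enc_nat n = (if n = 0 then Leaf
     else Node (if odd n then Node Leaf Leaf else Leaf) (enc_nat (n div 2)))"

declare enc_nat.simps [simp del]

definition enc_prod :: "('a \<Rightarrow> val) \<Rightarrow> ('b \<Rightarrow> val) \<Rightarrow> 'a \<times> 'b \<Rightarrow> val" where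
  "enc_prod f g = (\<lambda>(x, y). Node (f x) (g y))"

definition enc_list :: "('a \<Rightarrow> val) \<Rightarrow> 'a list \<Rightarrow> val" where
  "enc_list f xs = foldr (\<lambda>x. Node (f x)) xs Leaf"

text \<open>Only used for nonnegative rationals.\<close>

definition enc_rat :: "rat \<Rightarrow> val" where
  "enc_rat q = enc_prod (enc_nat \<circ> nat) (enc_nat \<circ> nat) (quotient_of q)"


lemma inj_enc_nat: "inj enc_nat"
proof (rule injI)
  show "x = y" if "enc_nat x = enc_nat y" for x y
    using that
  proof (induction x arbitrary: y rule: less_induct)
    case (less x)
    show ?case
    proof (cases "x = 0 \<or> y = 0")
      case True
      then show ?thesis
        using less.prems by (auto simp: enc_nat.simps[of x] enc_nat.simps[of y] split: if_splits)
    next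
      case False
      then have "enc_nat (x div 2) = enc_nat (y div 2)" and par: "odd x = odd y"
        using less.prems by (auto simp: enc_nat.simps[of x] enc_nat.simps[of y] split: if_splits)
      then have "x div 2 = y div 2"
        using False less.IH by simp
      with par show ?thesis
        by (metis odd_two_times_div_two_succ even_two_times_div_two)
    qed
  qed
qed

lemma inj_enc_prod: "inj f \<Longrightarrow> inj g \<Longrightarrow> inj (enc_prod f g)"
  by (auto simp: inj_def enc_prod_def)

lemma inj_enc_list: "inj f \<Longrightarrow> inj (enc_list f)"
proof (rule injI)
  show "xs = ys" if "inj f" "enc_list f xs = enc_list f ys" for xs ys
    using that(2)
  proof (induction xs arbitrary: ys)
    case Nil
    then show ?case by (cases ys) (auto simp: enc_list_def)
  next
    case (Cons x xs)
    then show ?case using \<open>inj f\<close> by (cases ys) (auto simp: enc_list_def inj_eq)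
  qed
qed


section \<open>Inputs\<close>

text \<open>The depot is 0 and the clients are 1, ..., n. An input consists of the list of edges
  \<open>(u, v, w)\<close>, each listed once and in one direction, with rational weight \<open>w\<close>, and of the list of
  the turnover times of the clients 1, ..., n.\<close>

type_synonym input = "(nat \<times> nat \<times> rat) list \<times> nat list"

definition in_graph :: "input \<Rightarrow> nat pair_pre_digraph" where
  "in_graph I = \<lparr> pverts = {0..length (snd I)},
     parcs = (\<Union>(u, v, w)\<in>set (fst I). {(u, v), (v, u)}) \<rparr>"

definition in_weight :: "input \<Rightarrow> (nat \<times> nat) weight_fun" where
  "in_weight I = (\<lambda>(x, y). case find (\<lambda>(u, v, w). {u, v} = {x, y}) (fst I) of
     Some (u, v, w) \<Rightarrow> real_of_rat w | None \<Rightarrow> 0)"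

definition in_turnover :: "input \<Rightarrow> nat \<Rightarrow> nat" where
  "in_turnover I v = snd I ! (v - 1)"

definition tree_input :: "input \<Rightarrow> bool" where
  "tree_input I \<longleftrightarrow> distinct (map (\<lambda>(u, v, w). {u, v}) (fst I)) \<and>
     rftt_tree (in_graph I) 0 (in_weight I) (in_turnover I)"

definition enc_input :: "input \<Rightarrow> val" where
  "enc_input = enc_prod (enc_list (enc_prod enc_nat (enc_prod enc_nat enc_rat))) (enc_list enc_nat)"


section \<open>Compact descriptions of solutions\<close>

text \<open>The least period of a solution may be exponential in the input size, so solutions cannot be
  listed day by day. A schedule consists of a period and of a list of rules \<open>(r, m, T, J)\<close>: on each
  day congruent to \<open>r\<close> modulo \<open>m\<close>, make the tour \<open>T\<close> and visit the clients \<open>J\<close>, unless an earlier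
  rule of the list applies. Every periodic solution can be written in this way, taking for all \<open>m\<close>
  the period.\<close>

type_synonym schedule = "nat \<times> (nat \<times> nat \<times> (nat \<times> nat) awalk \<times> nat list) list"

definition sched_day :: "schedule \<Rightarrow> nat \<Rightarrow> (nat \<times> nat) awalk \<times> nat set" where
  "sched_day S k = (case find (\<lambda>(r, m, T, J). k mod m = r mod m) (snd S) of
     Some (r, m, T, J) \<Rightarrow> (T, set J) | None \<Rightarrow> ([], {}))"

abbreviation sched_period :: "schedule \<Rightarrow> nat" where
  "sched_period \<equiv> fst"

abbreviation sched_tour :: "schedule \<Rightarrow> nat \<Rightarrow> (nat \<times> nat) awalk" where
  "sched_tour S \<equiv> \<lambda>k. fst (sched_day S k)"

abbreviation sched_visits :: "schedule \<Rightarrow> nat \<Rightarrow> nat set" where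
  "sched_visits S \<equiv> \<lambda>k. snd (sched_day S k)"

definition enc_schedule :: "schedule \<Rightarrow> val" where
  "enc_schedule = enc_prod enc_nat (enc_list (enc_prod enc_nat (enc_prod enc_nat
     (enc_prod (enc_list (enc_prod enc_nat enc_nat)) (enc_list enc_nat)))))"

lemma inj_enc_schedule: "inj enc_schedule"
  unfolding enc_schedule_def by (intro inj_enc_prod inj_enc_list inj_enc_nat)

end

theory Submission
  imports Defs
begin

text \<open>Round every turnover time down to a power of two and visit a client on the days divisible by
  its rounded turnover time, on a tour that crosses every edge of the smallest subtree spanned by the
  depot and the clients of the day exactly twice. If \<open>\<tau>\<close> is the least turnover time of the clients beyond
  an edge, every feasible solution crosses this edge back and forth on at least one of any \<open>\<tau>\<close>
  consecutive days, whereas the schedule does so only once every \<open>\<tau>'\<close> days for some \<open>\<tau>' > \<tau> / 2\<close>;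
  summing over the edges gives the factor 2.

  On a day \<open>k\<close> the schedule depends only on the largest power of two that divides \<open>k\<close>, capped at the
  period, so it is described by one rule per power of two. The tours come from a list of arcs
  of the tree in which parents precede children: scanning it from the leaves shows which arcs are
  needed, and each needed arc \<open>(p, v)\<close> is inserted as a detour \<open>p, v, p\<close> into the tour built from
  the arcs before it. No arithmetic on the weights is needed.\<close>


section \<open>The algorithm\<close>

text \<open>A tree is grown as the list of its arcs, which point away from the root \<open>r\<close>, latest arc first.\<close>

definition visited :: "'a \<Rightarrow> ('a \<times> 'a) list \<Rightarrow> 'a set" where
  "visited r D = insert r (snd ` set D)"

text \<open>An edge with both ends still missing is left for a later sweep.\<close>

fun attach :: "'a \<Rightarrow> 'a \<Rightarrow> 'a \<Rightarrow> ('a \<times> 'a) list \<Rightarrow> ('a \<times> 'a) list" where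
  "attach r u v D =
     (if u \<in> visited r D then if v \<in> visited r D then D else (u, v) # D
      else if v \<in> visited r D then (v, u) # D else D)"

declare attach.simps [simp del]

fun sweep :: "'a \<Rightarrow> ('a \<times> 'a \<times> 'b) list \<Rightarrow> ('a \<times> 'a) list \<Rightarrow> ('a \<times> 'a) list" where
  "sweep r [] D = D"
| "sweep r ((u, v, w) # E) D = sweep r E (attach r u v D)"

text \<open>Repeated sweeps replace a graph search: while a vertex is missing, connectedness makes
  every sweep add at least one, so one sweep per client is enough.\<close>

fun spanning :: "'a \<Rightarrow> nat \<Rightarrow> ('a \<times> 'a \<times> 'b) list \<Rightarrow> ('a \<times> 'a) list" where
  "spanning r 0 E = []"
| "spanning r (Suc n) E = sweep r E (spanning r n E)"

text \<open>A walk through \<open>p\<close> either has an arc leaving \<open>p\<close>, before which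
  the detour is inserted, or meets \<open>p\<close> only at its end, where appending is
  correct.\<close>

fun detour :: "'a \<Rightarrow> 'a \<Rightarrow> ('a \<times> 'a) list \<Rightarrow> ('a \<times> 'a) list" where
  "detour p v [] = [(p, v), (v, p)]"
| "detour p v ((a, b) # T) = (if a = p then (p, v) # (v, p) # (a, b) # T else (a, b) # detour p v T)"

declare detour.simps [simp del]

text \<open>\<open>N\<close> collects the vertices to be reached. In a grown list the arcs below
  \<open>v\<close> precede \<open>(p, v)\<close>, so \<open>v\<close> has been marked by then if any
  vertex below it is needed; needing \<open>v\<close> in turn marks \<open>p\<close>.\<close>

fun tour :: "('a \<times> 'a) list \<Rightarrow> 'a list \<Rightarrow> ('a \<times> 'a) list" where
  "tour [] N = []"
| "tour ((p, v) # D) N = (if v \<in> set N then detour p v (tour D (p # N)) else tour D N)"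

text \<open>Compares the lengths of the binary representations.\<close>

fun no_longer :: "nat \<Rightarrow> nat \<Rightarrow> bool" where
  "no_longer t m = (if t = 0 then True else if m = 0 then False else no_longer (t div 2) (m div 2))"

declare no_longer.simps [simp del]

text \<open>The clients \<open>i\<close>, \<open>i + 1\<close>, ... have the turnover times \<open>ts\<close>; for a power of two \<open>m\<close>,
  those are selected whose turnover time rounded down to a power of two divides \<open>m\<close>.\<close>

fun due :: "nat \<Rightarrow> nat \<Rightarrow> nat list \<Rightarrow> nat list" where
  "due m i [] = []"
| "due m i (t # ts) = (if no_longer t m then i # due m (Suc i) ts else due m (Suc i) ts)"

fun bitlen :: "nat \<Rightarrow> nat" where
  "bitlen n = (if n = 0 then 0 else Suc (bitlen (n div 2)))"

declare bitlen.simps [simp del]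

text \<open>For a power of two \<open>m\<close> the moduli decrease down to 1, so the first rule
  that applies belongs to the largest of these powers dividing the day, and modulus 1 always
  applies.\<close>

fun rules :: "nat \<Rightarrow> (nat \<times> nat) list \<Rightarrow> nat list
    \<Rightarrow> (nat \<times> nat \<times> (nat \<times> nat) list \<times> nat list) list" where
  "rules m D ts = (if m = 0 then []
     else (0, m, tour D (due m 1 ts), due m 1 ts) # rules (m div 2) D ts)"

declare rules.simps [simp del]

text \<open>Any large enough power of two would do as the period; the exponent chosen here, the total
  number of bits of the turnover times, is easy to compute.\<close>

definition solve :: "input \<Rightarrow> schedule" where
  "solve I = (let D = spanning 0 (length (snd I)) (fst I); M = 2 ^ sum_list (map bitlen (snd I))
     in (M, rules M D (snd I)))"


section \<open>A program for the algorithm\<close>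

text \<open>In tests the leaf counts as true, because the leaf branch of \<^const>\<open>ECase\<close> binds no
  variables and so leaves the de Bruijn indices unchanged.\<close>

definition truth :: "bool \<Rightarrow> val" where
  "truth b = (if b then Leaf else Node Leaf Leaf)"

abbreviation eFalse :: exp where "eFalse \<equiv> ENode ELeaf ELeaf"

definition "fMain = (0 :: nat)"
definition "fEq = (1 :: nat)"
definition "fVisited = (2 :: nat)"
definition "fAttach = (3 :: nat)"
definition "fSweep = (4 :: nat)"
definition "fSpan = (5 :: nat)"
definition "fMember = (6 :: nat)"
definition "fDetour = (7 :: nat)"
definition "fTour = (8 :: nat)"
definition "fNoLonger = (9 :: nat)"
definition "fInc = (10 :: nat)"
definition "fDue = (11 :: nat)"
definition "fShift = (12 :: nat)"
definition "fPeriod = (13 :: nat)"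
definition "fRules = (14 :: nat)"

text \<open>The functions and their arguments, the first one having index 0:
  \<open>Main [I]\<close>, \<open>Eq [x, y]\<close>, \<open>Visited [x, D]\<close>, \<open>Attach [u, v, D]\<close>, \<open>Sweep [E, D]\<close>, \<open>Span [F, E]\<close>,
  \<open>Member [x, N]\<close>, \<open>Detour [p, v, T]\<close>, \<open>Tour [D, N]\<close>, \<open>NoLonger [t, m]\<close>, \<open>Inc [i]\<close>, \<open>Due [m, i, ts]\<close>,
  \<open>Shift [t, m]\<close>, \<open>Period [ts]\<close>, \<open>Rules [m, D, ts]\<close>.\<close>

definition body_Main :: exp where
  "body_Main =
    ECase (EVar 0) ELeaf
      (ELet (ECall fSpan [EVar 1, EVar 0])
        (ELet (ECall fPeriod [EVar 2])
          (ENode (EVar 0) (ECall fRules [EVar 0, EVar 1, EVar 3]))))"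

definition body_Eq :: exp where
  "body_Eq =
    ECase (EVar 0)
      (ECase (EVar 1) ELeaf eFalse)
      (ECase (EVar 3) eFalse
        (ECase (ECall fEq [EVar 2, EVar 0]) (ECall fEq [EVar 3, EVar 1]) eFalse))"

definition body_Visited :: exp where
  "body_Visited =
    ECase (EVar 1)
      (ECase (EVar 0) ELeaf eFalse)
      (ECase (EVar 0) ELeaf
        (ECase (ECall fEq [EVar 4, EVar 1]) ELeaf (ECall fVisited [EVar 6, EVar 5])))"

definition body_Attach :: exp where
  "body_Attach =
    ECase (ECall fVisited [EVar 0, EVar 2])
      (ECase (ECall fVisited [EVar 1, EVar 2]) (EVar 2) (ENode (ENode (EVar 2) (EVar 3)) (EVar 4)))
      (ECase (ECall fVisited [EVar 3, EVar 4]) (ENode (ENode (EVar 3) (EVar 2)) (EVar 4)) (EVar 6))"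

definition body_Sweep :: exp where
  "body_Sweep =
    ECase (EVar 0) (EVar 1)
      (ECase (EVar 0) ELeaf
        (ECase (EVar 1) ELeaf
          (ECall fSweep [EVar 5, ECall fAttach [EVar 2, EVar 0, EVar 7]])))"

text \<open>The first argument counts the sweeps in unary; \<open>body_Main\<close> passes the list
  of turnover times, which has one entry per client.\<close>

definition body_Span :: exp where
  "body_Span =
    ECase (EVar 0) ELeaf
      (ECall fSweep [EVar 3, ECall fSpan [EVar 1, EVar 3]])"

definition body_Member :: exp where
  "body_Member =
    ECase (EVar 1) eFalse
      (ECase (ECall fEq [EVar 2, EVar 0]) ELeaf (ECall fMember [EVar 4, EVar 3]))"

definition body_Detour :: exp where
  "body_Detour =
    ECase (EVar 2)
      (ENode (ENode (EVar 0) (EVar 1)) (ENode (ENode (EVar 1) (EVar 0)) ELeaf))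
      (ECase (EVar 0) ELeaf
        (ECase (ECall fEq [EVar 0, EVar 4])
          (ENode (ENode (EVar 4) (EVar 5)) (ENode (ENode (EVar 5) (EVar 4)) (EVar 6)))
          (ENode (EVar 4) (ECall fDetour [EVar 6, EVar 7, EVar 5]))))"

definition body_Tour :: exp where
  "body_Tour =
    ECase (EVar 0) ELeaf
      (ECase (EVar 0) ELeaf
        (ECase (ECall fMember [EVar 1, EVar 5])
          (ECall fDetour [EVar 0, EVar 1, ECall fTour [EVar 3, ENode (EVar 0) (EVar 5)]])
          (ECall fTour [EVar 5, EVar 7])))"

text \<open>With the least significant bit first, halving a number is taking the right subtree of
  its code.\<close>

definition body_NoLonger :: exp where
  "body_NoLonger =
    ECase (EVar 0) ELeaf
      (ECase (EVar 3) eFalse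
        (ECall fNoLonger [EVar 3, EVar 1]))"

text \<open>\<open>eFalse\<close> doubles as the bit 1, so that \<open>ENode eFalse ELeaf\<close> is
  the number 1.\<close>

definition body_Inc :: exp where
  "body_Inc =
    ECase (EVar 0) (ENode eFalse ELeaf)
      (ECase (EVar 0) (ENode eFalse (EVar 1)) (ENode ELeaf (ECall fInc [EVar 3])))"

definition body_Due :: exp where
  "body_Due =
    ECase (EVar 2) ELeaf
      (ELet (ECall fDue [EVar 2, ECall fInc [EVar 3], EVar 1])
        (ECase (ECall fNoLonger [EVar 1, EVar 3]) (ENode (EVar 4) (EVar 0)) (EVar 2)))"

text \<open>One zero bit is put in front of \<open>m\<close> for each bit of \<open>t\<close>, which
  multiplies \<open>m\<close> by \<open>2 ^ bitlen t\<close>.\<close>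

definition body_Shift :: exp where
  "body_Shift =
    ECase (EVar 0) (EVar 1)
      (ENode ELeaf (ECall fShift [EVar 1, EVar 3]))"

definition body_Period :: exp where
  "body_Period =
    ECase (EVar 0) (ENode eFalse ELeaf)
      (ECall fShift [EVar 0, ECall fPeriod [EVar 1]])"

definition body_Rules :: exp where
  "body_Rules =
    ECase (EVar 0) ELeaf
      (ELet (ECall fDue [EVar 2, ENode eFalse ELeaf, EVar 4])
        (ENode
          (ENode ELeaf (ENode (EVar 3) (ENode (ECall fTour [EVar 4, EVar 0]) (EVar 0))))
          (ECall fRules [EVar 2, EVar 4, EVar 5])))"

definition sched_prog :: prog where
  "sched_prog = [body_Main, body_Eq, body_Visited, body_Attach, body_Sweep,
    body_Span, body_Member, body_Detour, body_Tour, body_NoLonger, body_Inc, body_Due,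
    body_Shift, body_Period, body_Rules]"

lemmas index_defs = fMain_def fEq_def fVisited_def fAttach_def fSweep_def fSpan_def fMember_def
  fDetour_def fTour_def fNoLonger_def fInc_def fDue_def fShift_def fPeriod_def fRules_def

lemma sched_prog_nth:
  "sched_prog ! fMain = body_Main"
  "sched_prog ! fEq = body_Eq"
  "sched_prog ! fVisited = body_Visited"
  "sched_prog ! fAttach = body_Attach"
  "sched_prog ! fSweep = body_Sweep"
  "sched_prog ! fSpan = body_Span"
  "sched_prog ! fMember = body_Member"
  "sched_prog ! fDetour = body_Detour"
  "sched_prog ! fTour = body_Tour"
  "sched_prog ! fNoLonger = body_NoLonger"
  "sched_prog ! fInc = body_Inc"
  "sched_prog ! fDue = body_Due"
  "sched_prog ! fShift = body_Shift"
  "sched_prog ! fPeriod = body_Period"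
  "sched_prog ! fRules = body_Rules"
  by (simp_all add: sched_prog_def index_defs)

lemma index_less:
  "fMain < length sched_prog"
  "fEq < length sched_prog"
  "fVisited < length sched_prog"
  "fAttach < length sched_prog"
  "fSweep < length sched_prog"
  "fSpan < length sched_prog"
  "fMember < length sched_prog"
  "fDetour < length sched_prog"
  "fTour < length sched_prog"
  "fNoLonger < length sched_prog"
  "fInc < length sched_prog"
  "fDue < length sched_prog"
  "fShift < length sched_prog"
  "fPeriod < length sched_prog"
  "fRules < length sched_prog"
  by (simp_all add: sched_prog_def index_defs)

section \<open>Evaluation with upper bounds on the cost\<close>

text \<open>In the time bounds below, \<open>K\<close> exceeds the size of every value that is read, so that reading a
  variable costs at most \<open>K\<close>.\<close>

definition evb :: "val list \<Rightarrow> exp \<Rightarrow> val \<Rightarrow> nat \<Rightarrow> bool" where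
  "evb \<rho> e v B \<longleftrightarrow> (\<exists>t\<le>B. eval sched_prog \<rho> e v t)"

definition evbs :: "val list \<Rightarrow> exp list \<Rightarrow> val list \<Rightarrow> nat \<Rightarrow> bool" where
  "evbs \<rho> es vs B \<longleftrightarrow> (\<exists>t\<le>B. evals sched_prog \<rho> es vs t)"

definition call :: "nat \<Rightarrow> val list \<Rightarrow> val \<Rightarrow> nat \<Rightarrow> bool" where
  "call f vs v B \<longleftrightarrow> f < length sched_prog \<and> evb vs (sched_prog ! f) v B"

lemma evb_Var: "i < length \<rho> \<Longrightarrow> size (\<rho> ! i) < K \<Longrightarrow> evb \<rho> (EVar i) (\<rho> ! i) K"
  unfolding evb_def using eval_Var by (metis Suc_eq_plus1 Suc_leI)

lemma evb_Vars:
  "size a < K \<Longrightarrow> evb (a # \<rho>) (EVar 0) a K"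
  "size b < K \<Longrightarrow> evb (a # b # \<rho>) (EVar 1) b K"
  "size b < K \<Longrightarrow> evb (a # b # \<rho>) (EVar (Suc 0)) b K"
  "size d < K \<Longrightarrow> evb (a # b # d # \<rho>) (EVar 2) d K"
  "size e < K \<Longrightarrow> evb (a # b # d # e # \<rho>) (EVar 3) e K"
  "size f < K \<Longrightarrow> evb (a # b # d # e # f # \<rho>) (EVar 4) f K"
  "size g < K \<Longrightarrow> evb (a # b # d # e # f # g # \<rho>) (EVar 5) g K"
  "size h < K \<Longrightarrow> evb (a # b # d # e # f # g # h # \<rho>) (EVar 6) h K"
  "size i < K \<Longrightarrow> evb (a # b # d # e # f # g # h # i # \<rho>) (EVar 7) i K"
  by (use evb_Var[of 0 "a # \<rho>" K] evb_Var[of 1 "a # b # \<rho>" K] evb_Var[of 2 "a # b # d # \<rho>" K]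
      evb_Var[of 3 "a # b # d # e # \<rho>" K] evb_Var[of 4 "a # b # d # e # f # \<rho>" K]
      evb_Var[of 5 "a # b # d # e # f # g # \<rho>" K]
      evb_Var[of 6 "a # b # d # e # f # g # h # \<rho>" K]
      evb_Var[of 7 "a # b # d # e # f # g # h # i # \<rho>" K] in \<open>simp_all\<close>)

lemma evb_Leaf: "evb \<rho> ELeaf Leaf 1"
  unfolding evb_def using eval_Leaf by blast

lemma evb_Node: "evb \<rho> e1 v1 B1 \<Longrightarrow> evb \<rho> e2 v2 B2 \<Longrightarrow> evb \<rho> (ENode e1 e2) (Node v1 v2) (B1 + B2 + 1)"
  unfolding evb_def by (meson add_mono eval_Node le_refl)

lemma evb_Case: "evb \<rho> e x B1 \<Longrightarrow>
    (case x of Leaf \<Rightarrow> evb \<rho> e1 v B2 | Node a b \<Rightarrow> evb (a # b # \<rho>) e2 v B2) \<Longrightarrow>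
    evb \<rho> (ECase e e1 e2) v (B1 + B2 + 1)"
proof (cases x)
  case Leaf
  assume "evb \<rho> e x B1" "case x of Leaf \<Rightarrow> evb \<rho> e1 v B2 | Node a b \<Rightarrow> evb (a # b # \<rho>) e2 v B2"
  then show ?thesis
    unfolding evb_def Leaf val.case by (meson add_mono eval_Case_Leaf le_refl)
next
  case (Node a b)
  assume "evb \<rho> e x B1" "case x of Leaf \<Rightarrow> evb \<rho> e1 v B2 | Node a b \<Rightarrow> evb (a # b # \<rho>) e2 v B2"
  then show ?thesis
    unfolding evb_def Node val.case by (meson add_mono eval_Case_Node le_refl)
qed

lemma evb_Let: "evb \<rho> e1 v1 B1 \<Longrightarrow> evb (v1 # \<rho>) e2 v B2 \<Longrightarrow> evb \<rho> (ELet e1 e2) v (B1 + B2 + 1)"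
  unfolding evb_def by (meson add_mono eval_Let le_refl)

lemma evb_Call: "evbs \<rho> es vs B1 \<Longrightarrow> call f vs v B2 \<Longrightarrow> evb \<rho> (ECall f es) v (B1 + B2 + 1)"
  unfolding evb_def evbs_def call_def by (meson add_mono eval_Call le_refl)

lemma evbs_Nil: "evbs \<rho> [] [] 0"
  unfolding evbs_def using evals_Nil by blast

lemma evbs_Cons: "evb \<rho> e v B1 \<Longrightarrow> evbs \<rho> es vs B2 \<Longrightarrow> evbs \<rho> (e # es) (v # vs) (B1 + B2)"
  unfolding evb_def evbs_def by (meson add_mono evals_Cons)

lemma callI: "f < length sched_prog \<Longrightarrow> evb vs (sched_prog ! f) v B \<Longrightarrow> B \<le> B' \<Longrightarrow> call f vs v B'"
  unfolding call_def evb_def by (meson order_trans)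

lemma call_weaken: "call f vs v B \<Longrightarrow> B \<le> B' \<Longrightarrow> call f vs v B'"
  unfolding call_def evb_def by (meson order_trans)

lemmas evb_intros = evb_Leaf evb_Node evb_Let evb_Case evb_Call evbs_Nil evbs_Cons

lemma truth_simps [simp]: "truth True = Leaf" "truth False = Node Leaf Leaf"
  by (auto simp: truth_def)

lemma le_power: "(K::nat) \<le> K ^ 2" "(K::nat) \<le> K ^ 3" "(K::nat) \<le> K ^ 4"
  by (cases "K = 0"; simp add: self_le_power)+

lemma iterate_bound: "n \<le> K \<Longrightarrow> n * (c * K ^ d) \<le> c * (K::nat) ^ Suc d"
  by (simp add: mult.left_commute mult_le_mono1)

text \<open>The outcome of a test is not known when a body is evaluated symbolically; the maximum
  puts both branches under one bound and so fits \<open>evb_Case\<close>.\<close>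

lemma case_truth:
  "(b \<Longrightarrow> evb \<rho> e1 v B1) \<Longrightarrow> (\<not> b \<Longrightarrow> evb (Leaf # Leaf # \<rho>) e2 v B2) \<Longrightarrow>
    (case truth b of Leaf \<Rightarrow> evb \<rho> e1 v (max B1 B2) | Node x y \<Rightarrow> evb (x # y # \<rho>) e2 v (max B1 B2))"
  by (cases b) (simp_all add: evb_def, (meson max.cobounded1 max.cobounded2 order_trans)+)

text \<open>The factor \<open>2 * size x + 1\<close> counts the nodes and leaves of
  \<open>x\<close>; each of them is the first argument of at most one recursive call.\<close>

lemma call_Eq_aux:
  "size x < K \<Longrightarrow> size y < K \<Longrightarrow> call fEq [x, y] (truth (x = y)) ((2 * size x + 1) * (20 * K))"
proof (induction x arbitrary: y)
  case Leaf
  show ?case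
    by (cases y; insert Leaf; rule callI, simp add: index_less,
        simp add: sched_prog_nth body_Eq_def,
       (rule evb_intros evb_Vars[where K=K] | simp)+)
next
  case (Node x1 x2)
  show ?case
  proof (cases y)
    case Leaf
    show ?thesis
      by (insert Node.prems, unfold Leaf, rule callI, simp add: index_less,
        simp add: sched_prog_nth body_Eq_def,
        (rule evb_intros evb_Vars[where K=K] | simp)+)
  next
    case y: (Node y1 y2)
    show ?thesis
      by (insert Node.prems, unfold y, rule callI, simp add: index_less,
        simp add: sched_prog_nth body_Eq_def,
        (rule evb_intros evb_Vars[where K=K] Node.IH case_truth | simp)+, simp add: algebra_simps)
  qed
qed

lemma call_Eq:
  assumes "size x < K" "size y < K"
  shows "call fEq [x, y] (truth (x = y)) (40 * K ^ 2)"
proof (rule call_weaken[OF call_Eq_aux[OF assms]])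
  have "(2 * size x + 1) * (20 * K) \<le> (2 * K) * (20 * K)"
    using assms by (intro mult_le_mono) auto
  then show "(2 * size x + 1) * (20 * K) \<le> 40 * K ^ 2"
    by (simp add: power2_eq_square)
qed

lemma enc_list_simps [simp]:
  "enc_list f [] = Leaf" "enc_list f (x # xs) = Node (f x) (enc_list f xs)"
  by (simp_all add: enc_list_def)

lemma enc_prod_simp [simp]: "enc_prod f g (x, y) = Node (f x) (g y)"
  by (simp add: enc_prod_def)

lemma enc_nat_0 [simp]: "enc_nat 0 = Leaf"
  by (simp add: enc_nat.simps)

lemma enc_nat_pos: "n > 0 \<Longrightarrow> enc_nat n = Node (if odd n then Node Leaf Leaf else Leaf) (enc_nat (n div 2))"
  by (simp add: enc_nat.simps)

lemma enc_nat_eq_iff [simp]: "enc_nat x = enc_nat y \<longleftrightarrow> x = y"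
  by (rule inj_eq[OF inj_enc_nat])

lemma length_le_size_enc_list: "length xs \<le> size (enc_list f xs)"
  by (induction xs) auto

section \<open>Running time of growing the tree\<close>

abbreviation (input) enc_pairs :: "(nat \<times> nat) list \<Rightarrow> val" where
  "enc_pairs \<equiv> enc_list (enc_prod enc_nat enc_nat)"

abbreviation (input) enc_edges :: "(nat \<times> nat \<times> rat) list \<Rightarrow> val" where
  "enc_edges \<equiv> enc_list (enc_prod enc_nat (enc_prod enc_nat enc_rat))"

text \<open>Sizes of lists are estimated as length times entry size; \<open>s\<close> bounds the
  codes of all vertices that can occur as entries.\<close>

definition small :: "nat \<Rightarrow> nat set" where
  "small s = {x. size (enc_nat x) \<le> s}"

lemma size_enc_pairs: "set D \<subseteq> small s \<times> small s \<Longrightarrow> size (enc_pairs D) \<le> length D * (2 * s + 2)"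
  by (induction D) (auto simp: small_def)

lemma size_enc_nats: "set N \<subseteq> small s \<Longrightarrow> size (enc_list enc_nat N) \<le> length N * (s + 1)"
  by (induction N) (auto simp: small_def)

lemma visited_simps [simp]:
  "visited r [] = {r}" "visited r (e # D) = insert (snd e) (visited r D)"
  by (auto simp: visited_def)

lemma call_Visited_aux:
  "size (enc_nat x) < K \<Longrightarrow> size (enc_pairs D) < K \<Longrightarrow>
    call fVisited [enc_nat x, enc_pairs D] (truth (x \<in> visited 0 D)) (Suc (length D) * (60 * K ^ 2))"
proof (induction D)
  case Nil
  \<comment> \<open>With no arcs left, only the root 0 is visited, and its code is the leaf; hence
    the test on a general value \<open>y\<close>.\<close>
  have "call fVisited [y, Leaf] (truth (y = Leaf)) (60 * K ^ 2)" if "size y < K" for y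
    by (cases y; insert that le_power(1)[of K];
      rule callI, simp add: index_less,
        simp add: sched_prog_nth body_Visited_def,
      (rule evb_intros evb_Vars[where K=K] | simp)+)
  from this[OF Nil(1)] show ?case
    by (simp add: enc_nat_pos split: if_splits) (metis enc_nat_pos enc_nat_0 val.distinct(1) gr0I)
next
  case (Cons e D)
  obtain u v where e: "e = (u, v)" by (cases e)
  show ?case
    by (insert Cons.prems le_power(1)[of K], unfold e,
      rule callI, simp add: index_less,
        simp add: sched_prog_nth body_Visited_def,
      (rule evb_intros evb_Vars[where K=K] call_Eq[where K=K] Cons.IH case_truth | simp)+)
qed

lemma call_Visited:
  assumes "size (enc_nat x) < K" "size (enc_pairs D) < K"
  shows "call fVisited [enc_nat x, enc_pairs D] (truth (x \<in> visited 0 D)) (60 * K ^ 3)"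
  using call_Visited_aux[OF assms] iterate_bound[of "Suc (length D)" K 60 2]
    assms(2) length_le_size_enc_list[of D "enc_prod enc_nat enc_nat"]
  by (simp add: numeral_3_eq_3 call_weaken)

lemma call_Attach:
  assumes "size (enc_nat u) < K" "size (enc_nat v) < K" "size (enc_pairs D) < K"
  shows "call fAttach [enc_nat u, enc_nat v, enc_pairs D] (enc_pairs (attach 0 u v D)) (140 * K ^ 3)"
  by (insert assms le_power(2)[of K], rule callI, simp add: index_less,
        simp add: sched_prog_nth body_Attach_def,
      (rule evb_intros evb_Vars[where K=K] call_Visited[where K=K] case_truth | simp add: attach.simps)+)

lemma size_enc_pairs_less:
  assumes "set D \<subseteq> small s \<times> small s" "length D \<le> l" "l * (2 * s + 2) < K"
  shows "size (enc_pairs D) < K"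
proof -
  have "length D * (2 * s + 2) \<le> l * (2 * s + 2)"
    using assms(2) by (rule mult_le_mono1)
  with size_enc_pairs[OF assms(1)] assms(3) show ?thesis by linarith
qed

lemma size_enc_nats_less:
  assumes "set N \<subseteq> small s" "length N \<le> l" "l * (s + 1) < K"
  shows "size (enc_list enc_nat N) < K"
proof -
  have "length N * (s + 1) \<le> l * (s + 1)"
    using assms(2) by (rule mult_le_mono1)
  with size_enc_nats[OF assms(1)] assms(3) show ?thesis by linarith
qed

lemma attach_bounds:
  "length (attach r u v D) \<le> Suc (length D)"
  "set (attach r u v D) \<subseteq> insert (u, v) (insert (v, u) (set D))"
  by (auto simp: attach.simps)

lemma sweep_bounds:
  "length (sweep r E D) \<le> length E + length D"
  "set (sweep r E D) \<subseteq> set D \<union> (\<Union>(u, v, w)\<in>set E. {(u, v), (v, u)})"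
proof (induction E arbitrary: D)
  case (Cons e E)
  obtain u v w where e: "e = (u, v, w)" by (cases e)
  { case 1 show ?case using Cons(1)[of "attach r u v D"] attach_bounds(1)[of r u v D] by (simp add: e) }
  { case 2 show ?case using Cons(2)[of "attach r u v D"] attach_bounds(2)[of r u v D] by (auto simp: e) }
qed auto

lemma span_bounds:
  "length (spanning r n E) \<le> n * length E"
  "set (spanning r n E) \<subseteq> (\<Union>(u, v, w)\<in>set E. {(u, v), (v, u)})"
proof (induction n)
  case (Suc n)
  { case 1 show ?case using Suc(1) sweep_bounds(1)[of r E "spanning r n E"] by simp }
  { case 2 show ?case using Suc(2) sweep_bounds(2)[of r E "spanning r n E"] by auto }
qed auto

text \<open>Each edge processed adds at most one arc, so \<open>length E + length D\<close> never
  grows; its bound \<open>l\<close> keeps the code of \<open>D\<close> below \<open>K\<close>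
  throughout the recursion.\<close>

lemma call_Sweep_aux:
  assumes "s < K"
  shows "size (enc_edges E) < K \<Longrightarrow> \<forall>(u, v, w)\<in>set E. u \<in> small s \<and> v \<in> small s \<Longrightarrow>
    set D \<subseteq> small s \<times> small s \<Longrightarrow> length E + length D \<le> l \<Longrightarrow> l * (2 * s + 2) < K \<Longrightarrow>
    call fSweep [enc_edges E, enc_pairs D] (enc_pairs (sweep 0 E D)) (Suc (length E) * (160 * K ^ 3))"
proof (induction E arbitrary: D)
  case Nil
  then have "size (enc_pairs D) < K"
    using size_enc_pairs_less[of D s l K] by simp
  with le_power(2)[of K] show ?case
    by - (rule callI, simp add: index_less,
        simp add: sched_prog_nth body_Sweep_def,
      (rule evb_intros evb_Vars[where K=K] | simp)+)
next
  case (Cons e E)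
  obtain u v w where e: "e = (u, v, w)" by (cases e)
  have D: "size (enc_pairs D) < K"
    using size_enc_pairs_less[of D s l K] Cons.prems by simp
  have s: "size (enc_nat u) < K" "size (enc_nat v) < K"
    using Cons.prems(2) assms by (auto simp: e small_def)
  have IH: "call fSweep [enc_edges E, enc_pairs (attach 0 u v D)] (enc_pairs (sweep 0 E (attach 0 u v D)))
    (Suc (length E) * (160 * K ^ 3))"
    using Cons.prems attach_bounds[of 0 u v D] by (intro Cons.IH) (auto simp: e)
  have "K \<le> K ^ 3" by (rule le_power)
  with D s Cons.prems(1) show ?case unfolding e
    by - (rule callI, simp add: index_less,
        simp add: sched_prog_nth body_Sweep_def,
      (rule evb_intros evb_Vars[where K=K] IH call_Attach[where K=K] | simp)+)
qed

lemma mult_Suc_le_cube: "Suc n \<le> K \<Longrightarrow> Suc n * (c * K ^ 2) \<le> c * (K::nat) ^ 3"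
  using iterate_bound[of "Suc n" K c 2] by (simp add: numeral_3_eq_3)

lemma call_Sweep:
  assumes "s < K" "size (enc_edges E) < K" "\<forall>(u, v, w)\<in>set E. u \<in> small s \<and> v \<in> small s"
    "set D \<subseteq> small s \<times> small s" "length E + length D \<le> l" "l * (2 * s + 2) < K"
  shows "call fSweep [enc_edges E, enc_pairs D] (enc_pairs (sweep 0 E D)) (160 * K ^ 4)"
proof (rule call_weaken[OF call_Sweep_aux[OF assms]])
  show "Suc (length E) * (160 * K ^ 3) \<le> 160 * K ^ 4"
    using iterate_bound[of "Suc (length E)" K 160 3] assms(2)
      length_le_size_enc_list[of E "enc_prod enc_nat (enc_prod enc_nat enc_rat)"]
    by (simp add: numeral_eq_Suc)
qed

lemma call_Span_aux:
  assumes "s < K" "size (enc_edges E) < K" "\<forall>(u, v, w)\<in>set E. u \<in> small s \<and> v \<in> small s"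
  shows "size (enc_list f F) < K \<Longrightarrow> length F * length E \<le> l \<Longrightarrow> l * (2 * s + 2) < K \<Longrightarrow>
    call fSpan [enc_list f F, enc_edges E] (enc_pairs (spanning 0 (length F) E)) (Suc (length F) * (180 * K ^ 4))"
proof (induction F)
  case Nil
  with le_power(3)[of K] assms(2) show ?case
    by - (rule callI, simp add: index_less,
        simp add: sched_prog_nth body_Span_def,
      (rule evb_intros evb_Vars[where K=K] | simp)+)
next
  case (Cons x F)
  have IH: "call fSpan [enc_list f F, enc_edges E]
    (enc_pairs (spanning 0 (length F) E)) (Suc (length F) * (180 * K ^ 4))"
    using Cons.prems by (intro Cons.IH) auto
  let ?D = "spanning 0 (length F) E"
  have "set ?D \<subseteq> small s \<times> small s"
    by (rule order_trans[OF span_bounds(2)]) (use assms(3) in auto)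
  then have S: "call fSweep [enc_edges E, enc_pairs ?D] (enc_pairs (sweep 0 E ?D)) (160 * K ^ 4)"
    using Cons.prems span_bounds(1)[of 0 "length F" E] by (intro call_Sweep[OF assms]) auto
  from le_power(3)[of K] assms(2) Cons.prems(1) show ?case
    by - (rule callI, simp add: index_less,
        simp add: sched_prog_nth body_Span_def,
      (rule evb_intros evb_Vars[where K=K] IH S | simp)+)
qed

lemma call_Span:
  assumes "s < K" "size (enc_edges E) < K" "\<forall>(u, v, w)\<in>set E. u \<in> small s \<and> v \<in> small s"
    "size (enc_list f F) < K" "length F * length E * (2 * s + 2) < K"
  shows "call fSpan [enc_list f F, enc_edges E] (enc_pairs (spanning 0 (length F) E)) (180 * K ^ 5)"
proof (rule call_weaken[OF call_Span_aux[OF assms(1-4) order_refl assms(5)]])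
  show "Suc (length F) * (180 * K ^ 4) \<le> 180 * K ^ 5"
    using iterate_bound[of "Suc (length F)" K 180 4] assms(4) length_le_size_enc_list[of F f]
    by (simp add: numeral_eq_Suc)
qed

section \<open>Running time of building the tours\<close>

lemma call_Member:
  assumes "size (enc_nat x) < K" "size (enc_list enc_nat N) < K"
  shows "call fMember [enc_nat x, enc_list enc_nat N] (truth (x \<in> set N)) (60 * K ^ 3)"
proof (rule call_weaken[OF _ mult_Suc_le_cube])
  show "Suc (length N) \<le> K"
    using assms(2) length_le_size_enc_list[of N enc_nat] by simp
  show "call fMember [enc_nat x, enc_list enc_nat N]
    (truth (x \<in> set N)) (Suc (length N) * (60 * K ^ 2))"
    using assms(2)
  proof (induction N)
    case Nil
    with le_power(1)[of K] assms(1) show ?case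
      by - (rule callI, simp add: index_less,
        simp add: sched_prog_nth body_Member_def,
        (rule evb_intros evb_Vars[where K=K] | simp)+)
  next
    case (Cons y N)
    from le_power(1)[of K] assms(1) Cons.prems show ?case
      by - (rule callI, simp add: index_less,
        simp add: sched_prog_nth body_Member_def,
        (rule evb_intros evb_Vars[where K=K] call_Eq[where K=K] Cons.IH case_truth | simp)+)
  qed
qed

lemma call_Detour:
  assumes "size (enc_nat p) < K" "size (enc_nat v) < K" "size (enc_pairs T) < K"
  shows "call fDetour [enc_nat p, enc_nat v, enc_pairs T] (enc_pairs (detour p v T)) (60 * K ^ 3)"
proof (rule call_weaken[OF _ mult_Suc_le_cube])
  show "Suc (length T) \<le> K"
    using assms(3) length_le_size_enc_list[of T "enc_prod enc_nat enc_nat"] by simp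
  show "call fDetour [enc_nat p, enc_nat v, enc_pairs T]
    (enc_pairs (detour p v T)) (Suc (length T) * (60 * K ^ 2))"
    using assms(3)
  proof (induction T)
    case Nil
    with le_power(1)[of K] assms(1,2) show ?case
      by - (rule callI, simp add: index_less,
        simp add: sched_prog_nth body_Detour_def detour.simps,
        (rule evb_intros evb_Vars[where K=K] | simp)+)
  next
    case (Cons e T)
    obtain a b where e: "e = (a, b)" by (cases e)
    have IH: "call fDetour [enc_nat p, enc_nat v, enc_pairs T]
      (enc_pairs (detour p v T)) (Suc (length T) * (60 * K ^ 2))"
      using Cons by simp
    from le_power(1)[of K] assms(1,2) Cons.prems show ?case unfolding e
      by - (rule callI, simp add: index_less,
        simp add: sched_prog_nth body_Detour_def,
        (rule evb_intros evb_Vars[where K=K] call_Eq[where K=K] IH case_truth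
          | simp only: val.case enc_list_simps enc_prod_simp | simp add: detour.simps)+)
  qed
qed

lemma detour_bounds:
  "length (detour p v T) = length T + 2"
  "set (detour p v T) \<subseteq> {(p, v), (v, p)} \<union> set T"
  by (induction p v T rule: detour.induct) (auto simp: detour.simps split: if_splits)

lemma tour_bounds:
  "length (tour D N) \<le> 2 * length D"
  "set (tour D N) \<subseteq> set D \<union> (set D)\<inverse>"
proof (induction D arbitrary: N)
  case (Cons e D)
  obtain p v where e: "e = (p, v)" by (cases e)
  { case 1
    show ?case
      using Cons(1)[of N] Cons(1)[of "p # N"] detour_bounds(1)[of p v "tour D (p # N)"] by (simp add: e) }
  { case 2
    show ?case
      using Cons(2)[of N] Cons(2)[of "p # N"] detour_bounds(2)[of p v "tour D (p # N)"]
      by (auto simp: e) }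
qed auto

declare tour.simps [simp del]

text \<open>Only one of the two recursive calls is executed, so the time is linear in the number of
  arcs. Tours have at most \<open>2 * l\<close> arcs, and \<open>N\<close> gains at most one vertex
  per arc consumed, which is why \<open>l'\<close> bounds the sum of both lengths.\<close>

lemma call_Tour_aux:
  assumes "s < K" "2 * l * (2 * s + 2) < K"
  shows "set D \<subseteq> small s \<times> small s \<Longrightarrow> set N \<subseteq> small s \<Longrightarrow> length D \<le> l \<Longrightarrow>
    length N + length D \<le> l' \<Longrightarrow> l' * (s + 1) < K \<Longrightarrow>
    call fTour [enc_pairs D, enc_list enc_nat N] (enc_pairs (tour D N)) (Suc (length D) * (140 * K ^ 3))"
proof (induction D arbitrary: N)
  case Nil
  have "size (enc_list enc_nat N) < K"
    using size_enc_nats_less[of N s l' K] Nil by simp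
  with le_power(2)[of K] show ?case
    by - (rule callI, simp add: index_less,
        simp add: sched_prog_nth body_Tour_def tour.simps,
      (rule evb_intros evb_Vars[where K=K] | simp)+)
next
  case (Cons e D)
  obtain p v where e: "e = (p, v)" by (cases e)
  have pv: "size (enc_nat p) < K" "size (enc_nat v) < K" and N: "set (p # N) \<subseteq> small s"
    using Cons.prems(1,2) assms(1) by (auto simp: e small_def)
  have D: "size (enc_pairs (e # D)) < K"
    by (rule size_enc_pairs_less[of _ s "2 * l"]) (use Cons.prems assms in auto)
  have N1: "size (enc_list enc_nat (p # N)) < K" "size (enc_list enc_nat N) < K"
    by (rule size_enc_nats_less[of _ s l']; use N Cons.prems in auto)+
  have T: "size (enc_pairs (tour D (p # N))) < K"
  proof (rule size_enc_pairs_less[of _ s "2 * l"])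
    show "set (tour D (p # N)) \<subseteq> small s \<times> small s"
      by (rule order_trans[OF tour_bounds(2)]) (use Cons.prems(1) in auto)
    show "length (tour D (p # N)) \<le> 2 * l"
      using tour_bounds(1)[of D "p # N"] Cons.prems(3) by simp
  qed (use assms in auto)
  have IH1: "call fTour [enc_pairs D, Node (enc_nat p) (enc_list enc_nat N)] (enc_pairs (tour D (p # N)))
      (Suc (length D) * (140 * K ^ 3))"
    using Cons.IH[of "p # N"] Cons.prems N by simp
  have IH2: "call fTour [enc_pairs D, enc_list enc_nat N] (enc_pairs (tour D N))
      (Suc (length D) * (140 * K ^ 3))"
    using Cons.IH[of N] Cons.prems by simp
  note De = call_Detour[OF pv T]
  from le_power(2)[of K] pv D N1 show ?case unfolding e
    by - (rule callI, simp add: index_less,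
        simp add: sched_prog_nth body_Tour_def,
      (rule evb_intros evb_Vars[where K=K] call_Member[where K=K] De IH1 IH2 case_truth
        | simp only: val.case enc_list_simps enc_prod_simp | simp add: tour.simps)+)
qed

lemma call_Tour:
  assumes "s < K" "2 * length D * (2 * s + 2) < K" "set D \<subseteq> small s \<times> small s"
    "set N \<subseteq> small s" "(length N + length D) * (s + 1) < K"
  shows "call fTour [enc_pairs D, enc_list enc_nat N] (enc_pairs (tour D N)) (140 * K ^ 4)"
proof (rule call_weaken[OF call_Tour_aux[OF assms(1-4) order_refl order_refl assms(5)]])
  have "length D \<le> 2 * length D * (2 * s + 2)" by simp
  then show "Suc (length D) * (140 * K ^ 3) \<le> 140 * K ^ 4"
    using iterate_bound[of "Suc (length D)" K 140 3] assms(2) by (simp add: numeral_eq_Suc)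
qed

section \<open>Running time of the binary arithmetic and of listing the rules\<close>

lemma bitlen_0 [simp]: "bitlen 0 = 0"
  by (simp add: bitlen.simps)

lemma bitlen_pos: "n > 0 \<Longrightarrow> bitlen n = Suc (bitlen (n div 2))"
  by (simp add: bitlen.simps)

lemma bitlen_le_size: "bitlen n \<le> size (enc_nat n)"
  by (induction n rule: bitlen.induct) (subst bitlen.simps, auto simp: enc_nat_pos)

lemma size_enc_nat_le: "size (enc_nat n) \<le> 2 * n"
proof (induction n rule: less_induct)
  case (less n)
  show ?case
  proof (cases "n = 0")
    case False
    then have "size (enc_nat (n div 2)) \<le> 2 * (n div 2)"
      by (intro less.IH) auto
    with False show ?thesis by (simp add: enc_nat_pos) presburger
  qed simp
qed

lemma mult_bitlen_le: "size (enc_nat n) < K \<Longrightarrow> Suc (bitlen n) * (c * K) \<le> c * K ^ 2"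
  using iterate_bound[of "Suc (bitlen n)" K c 1] bitlen_le_size[of n] by (simp add: power2_eq_square)

lemma call_NoLonger_aux:
  "size (enc_nat t) < K \<Longrightarrow> size (enc_nat m) < K \<Longrightarrow>
    call fNoLonger [enc_nat t, enc_nat m] (truth (no_longer t m)) (Suc (bitlen t) * (20 * K))"
proof (induction t m rule: no_longer.induct)
  case (1 t m)
  consider "t = 0" | "t > 0" "m = 0" | "t > 0" "m > 0" by auto
  then show ?case
  proof cases
    assume t: "t = 0"
    from 1(3) show ?thesis unfolding t
      by - (rule callI, simp add: index_less,
        simp add: sched_prog_nth body_NoLonger_def no_longer.simps,
        (rule evb_intros evb_Vars[where K=K] | simp)+)
  next
    assume t: "t > 0" and m: "m = 0"
    obtain b where enc: "enc_nat t = Node b (enc_nat (t div 2))" using enc_nat_pos[OF t] by blast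
    have "truth (no_longer t m) = Node Leaf Leaf" using t m by (simp add: no_longer.simps)
    with 1(2) show ?thesis unfolding m enc
      by - (rule callI, simp add: index_less,
        simp add: sched_prog_nth body_NoLonger_def,
        (rule evb_intros evb_Vars[where K=K] | simp)+)
  next
    assume t: "t > 0" and m: "m > 0"
    obtain b where enc: "enc_nat t = Node b (enc_nat (t div 2))" using enc_nat_pos[OF t] by blast
    obtain b' where enc': "enc_nat m = Node b' (enc_nat (m div 2))" using enc_nat_pos[OF m] by blast
    have IH: "call fNoLonger [enc_nat (t div 2), enc_nat (m div 2)] (truth (no_longer (t div 2) (m div 2)))
      (Suc (bitlen (t div 2)) * (20 * K))"
      using 1 t m by (intro 1(1)) (auto simp: enc enc')
    have "truth (no_longer t m) = truth (no_longer (t div 2) (m div 2))"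
      using t m by (simp add: no_longer.simps[of t])
    with 1(2,3) show ?thesis unfolding enc enc' bitlen_pos[OF t]
      by - (rule callI, simp add: index_less,
        simp add: sched_prog_nth body_NoLonger_def,
        (rule evb_intros evb_Vars[where K=K] IH | simp)+)
  qed
qed

lemma call_NoLonger:
  assumes "size (enc_nat t) < K" "size (enc_nat m) < K"
  shows "call fNoLonger [enc_nat t, enc_nat m] (truth (no_longer t m)) (20 * K ^ 2)"
  by (rule call_weaken[OF call_NoLonger_aux[OF assms] mult_bitlen_le[OF assms(1)]])

lemma call_Inc_aux:
  "size (enc_nat n) < K \<Longrightarrow> call fInc [enc_nat n] (enc_nat (Suc n)) (Suc (bitlen n) * (20 * K))"
proof (induction n rule: bitlen.induct)
  case (1 n)
  consider "n = 0" | "even n" "n > 0" | "odd n" by blast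
  then show ?case
  proof cases
    assume n: "n = 0"
    have "enc_nat (Suc 0) = Node (Node Leaf Leaf) Leaf" by (simp add: enc_nat_pos)
    with 1(2) show ?thesis unfolding n
      by - (rule callI, simp add: index_less,
        simp add: sched_prog_nth body_Inc_def,
        (rule evb_intros evb_Vars[where K=K] | simp)+)
  next
    assume n: "even n" "n > 0"
    then have "enc_nat n = Node Leaf (enc_nat (n div 2))"
      "enc_nat (Suc n) = Node (Node Leaf Leaf) (enc_nat (n div 2))"
      by (simp_all add: enc_nat_pos)
    with 1(2) show ?thesis
      by - (rule callI, simp add: index_less,
        simp add: sched_prog_nth body_Inc_def,
        (rule evb_intros evb_Vars[where K=K] | simp)+)
  next
    assume n: "odd n"
    then have n0: "n > 0" by (simp add: odd_pos)
    from n have enc: "enc_nat n = Node (Node Leaf Leaf) (enc_nat (n div 2))"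
      by (simp add: enc_nat_pos odd_pos)
    have enc': "enc_nat (Suc n) = Node Leaf (enc_nat (Suc (n div 2)))"
      using n by (simp add: enc_nat_pos)
    have IH: "call fInc [enc_nat (n div 2)]
      (enc_nat (Suc (n div 2))) (Suc (bitlen (n div 2)) * (20 * K))"
      using 1 n0 by (intro 1(1)) (auto simp: enc)
    from 1(2) show ?thesis unfolding enc enc' bitlen_pos[OF n0]
      by - (rule callI, simp add: index_less,
        simp add: sched_prog_nth body_Inc_def,
        (rule evb_intros evb_Vars[where K=K] IH | simp)+)
  qed
qed

lemma call_Inc:
  assumes "size (enc_nat n) < K"
  shows "call fInc [enc_nat n] (enc_nat (Suc n)) (20 * K ^ 2)"
  by (rule call_weaken[OF call_Inc_aux[OF assms] mult_bitlen_le[OF assms(1)]])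

lemma due_bounds: "length (due m i ts) \<le> length ts" "set (due m i ts) \<subseteq> {i..<i + length ts}"
proof (induction ts arbitrary: i)
  case (Cons t ts)
  { case 1 show ?case using Cons(1)[of "Suc i"] by simp }
  { case 2 show ?case using Cons(2)[of "Suc i"] by auto }
qed auto

declare due.simps [simp del]

lemma due_small:
  assumes "2 * (i + length ts) \<le> s"
  shows "set (due m i ts) \<subseteq> small s"
proof
  fix x assume "x \<in> set (due m i ts)"
  then have "x < i + length ts" using due_bounds(2)[of m i ts] by auto
  then show "x \<in> small s"
    using assms size_enc_nat_le[of x] by (simp add: small_def)
qed

lemma size_enc_due_less:
  assumes "2 * (i + length ts) \<le> s" "length ts \<le> l" "l * (s + 1) < K"
  shows "size (enc_list enc_nat (due m i ts)) < K"
  by (rule size_enc_nats_less[OF due_small[OF assms(1)] _ assms(3)])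
    (use due_bounds(1)[of m i ts] assms(2) in simp)

lemma call_Due_aux:
  assumes "size (enc_nat m) < K" "s < K" "l * (s + 1) < K"
  shows "size (enc_list enc_nat ts) < K \<Longrightarrow> 2 * (i + length ts) \<le> s \<Longrightarrow> length ts \<le> l \<Longrightarrow>
    call fDue [enc_nat m, enc_nat i, enc_list enc_nat ts] (enc_list enc_nat (due m i ts))
      (Suc (length ts) * (60 * K ^ 2))"
proof (induction ts arbitrary: i)
  case Nil
  have "size (enc_nat i) < K"
    using size_enc_nat_le[of i] Nil assms(2) by simp
  with le_power(1)[of K] assms(1) show ?case
    by - (rule callI, simp add: index_less,
        simp add: sched_prog_nth body_Due_def due.simps,
        (rule evb_intros evb_Vars[where K=K] | simp)+)
next
  case (Cons t ts)
  have i: "size (enc_nat i) < K"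
    using size_enc_nat_le[of i] Cons assms(2) by simp
  have d: "size (enc_list enc_nat (due m (Suc i) ts)) < K"
    by (rule size_enc_due_less[OF _ _ assms(3)]) (use Cons.prems in auto)
  have IH: "call fDue [enc_nat m, enc_nat (Suc i), enc_list enc_nat ts] (enc_list enc_nat (due m (Suc i) ts))
      (Suc (length ts) * (60 * K ^ 2))"
    using Cons.prems by (intro Cons.IH) auto
  from le_power(1)[of K] assms(1) i d Cons.prems(1) show ?case
    by - (rule callI, simp add: index_less,
        simp add: sched_prog_nth body_Due_def,
        (rule evb_intros evb_Vars[where K=K] call_Inc[where K=K] call_NoLonger[where K=K] IH case_truth
        | simp only: val.case enc_list_simps | simp add: due.simps)+)
qed

lemma call_Due:
  assumes "size (enc_nat m) < K" "s < K" "length ts * (s + 1) < K" "size (enc_list enc_nat ts) < K"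
    "2 * (i + length ts) \<le> s"
  shows "call fDue [enc_nat m, enc_nat i, enc_list enc_nat ts]
    (enc_list enc_nat (due m i ts)) (60 * K ^ 3)"
  by (rule call_weaken[OF call_Due_aux[OF assms order_refl] mult_Suc_le_cube])
    (use assms(4) length_le_size_enc_list[of ts enc_nat] in simp)

lemma size_enc_nat_power: "size (enc_nat (2 ^ k)) = k + 2"
  by (induction k) (simp_all add: enc_nat_pos)

lemma call_Shift:
  assumes "a + bitlen t + 2 < K" "size (enc_nat t) < K"
  shows "call fShift [enc_nat t, enc_nat (2 ^ a)] (enc_nat (2 ^ (bitlen t + a))) (20 * K ^ 2)"
proof (rule call_weaken[OF _ mult_bitlen_le[OF assms(2)]])
  show "call fShift [enc_nat t, enc_nat (2 ^ a)]
    (enc_nat (2 ^ (bitlen t + a))) (Suc (bitlen t) * (20 * K))"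
    using assms(2)
  proof (induction t rule: bitlen.induct)
    case (1 t)
    have a: "size (enc_nat (2 ^ a)) < K" using assms(1) by (simp add: size_enc_nat_power)
    show ?case
    proof (cases "t = 0")
      case True
      from a show ?thesis unfolding True
        by - (rule callI, simp add: index_less,
        simp add: sched_prog_nth body_Shift_def,
          (rule evb_intros evb_Vars[where K=K] | simp)+)
    next
      case False
      then have t: "t > 0" by simp
      obtain b where enc: "enc_nat t = Node b (enc_nat (t div 2))" using enc_nat_pos[OF t] by blast
      have IH: "call fShift [enc_nat (t div 2), enc_nat (2 ^ a)] (enc_nat (2 ^ (bitlen (t div 2) + a)))
          (Suc (bitlen (t div 2)) * (20 * K))"
        using 1 False by (intro 1(1)) (auto simp: enc)
      have enc': "enc_nat (2 ^ (bitlen t + a)) = Node Leaf (enc_nat (2 ^ (bitlen (t div 2) + a)))"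
        by (simp add: bitlen_pos[OF t] enc_nat_pos)
      from a 1(2) show ?thesis unfolding enc' unfolding enc unfolding bitlen_pos[OF t]
        by - (rule callI, simp add: index_less,
        simp add: sched_prog_nth body_Shift_def,
          (rule evb_intros evb_Vars[where K=K] IH | simp)+)
    qed
  qed
qed

text \<open>The exponent of the period is at most the input size, so the period has a short code
  although it may be exponentially large.\<close>

lemma sum_bitlen_le_size: "sum_list (map bitlen ts) \<le> size (enc_list enc_nat ts)"
proof (induction ts)
  case (Cons t ts)
  then show ?case using bitlen_le_size[of t] by simp
qed simp

lemma call_Period:
  assumes "size (enc_list enc_nat ts) + 2 < K"
  shows "call fPeriod [enc_list enc_nat ts] (enc_nat (2 ^ sum_list (map bitlen ts))) (40 * K ^ 3)"
proof (rule call_weaken[OF _ mult_Suc_le_cube])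
  show "Suc (length ts) \<le> K"
    using assms length_le_size_enc_list[of ts enc_nat] by simp
  show "call fPeriod [enc_list enc_nat ts]
    (enc_nat (2 ^ sum_list (map bitlen ts))) (Suc (length ts) * (40 * K ^ 2))"
    using assms
  proof (induction ts)
    case Nil
    have "enc_nat (Suc 0) = Node (Node Leaf Leaf) Leaf" by (simp add: enc_nat_pos)
    with le_power(1)[of K] Nil show ?case
      by - (rule callI, simp add: index_less,
        simp add: sched_prog_nth body_Period_def,
          (rule evb_intros evb_Vars[where K=K] | simp)+)
  next
    case (Cons t ts)
    have IH: "call fPeriod [enc_list enc_nat ts]
      (enc_nat (2 ^ sum_list (map bitlen ts))) (Suc (length ts) * (40 * K ^ 2))"
      using Cons by simp
    have S: "call fShift [enc_nat t, enc_nat (2 ^ sum_list (map bitlen ts))]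
      (enc_nat (2 ^ (sum_list (map bitlen (t # ts))))) (20 * K ^ 2)"
      using call_Shift[of "sum_list (map bitlen ts)" t K] Cons.prems bitlen_le_size[of t] sum_bitlen_le_size[of ts]
      by simp
    from le_power(1)[of K] Cons.prems show ?case
      by - (rule callI, simp add: index_less,
        simp add: sched_prog_nth body_Period_def del: list.map,
          (rule evb_intros evb_Vars[where K=K] S IH | simp del: list.map)+)
  qed
qed

abbreviation (input) enc_rules ::
    "(nat \<times> nat \<times> (nat \<times> nat) list \<times> nat list) list \<Rightarrow> val" where
  "enc_rules \<equiv> enc_list (enc_prod enc_nat (enc_prod enc_nat
     (enc_prod (enc_list (enc_prod enc_nat enc_nat)) (enc_list enc_nat))))"

text \<open>There is one rule per bit of \<open>m\<close>, and each takes one call of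
  \<open>Due\<close> and one of \<open>Tour\<close>, of order \<open>K ^ 4\<close> together.\<close>

lemma call_Rules:
  assumes "s < K" "2 * (1 + length ts) \<le> s" "size (enc_list enc_nat ts) < K"
    "size (enc_pairs D) < K" "set D \<subseteq> small s \<times> small s" "2 * length D * (2 * s + 2) < K"
    "(length ts + length D) * (s + 1) < K" "size (enc_nat m) < K"
  shows "call fRules [enc_nat m, enc_pairs D, enc_list enc_nat ts]
    (enc_rules (rules m D ts)) (230 * K ^ 5)"
proof (rule call_weaken)
  show "Suc (bitlen m) * (230 * K ^ 4) \<le> 230 * K ^ 5"
    using iterate_bound[of "Suc (bitlen m)" K 230 4] bitlen_le_size[of m] assms(8)
    by (simp add: numeral_eq_Suc)
  show "call fRules [enc_nat m, enc_pairs D, enc_list enc_nat ts] (enc_rules (rules m D ts))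
    (Suc (bitlen m) * (230 * K ^ 4))"
    using assms(8)
  proof (induction m rule: bitlen.induct)
    case (1 m)
    show ?case
    proof (cases "m = 0")
      case True
      have "rules 0 D ts = []" by (simp add: rules.simps)
      with le_power(3)[of K] assms(3,4) show ?thesis unfolding True
        by - (rule callI, simp add: index_less,
        simp add: sched_prog_nth body_Rules_def,
          (rule evb_intros evb_Vars[where K=K] | simp)+)
    next
      case False
      define J where "J = due m 1 ts"
      from False have m: "m > 0" by simp
      obtain b where enc: "enc_nat m = Node b (enc_nat (m div 2))" using enc_nat_pos[OF m] by blast
      have l: "length ts * (s + 1) < K"
        using assms(7) by (simp add: algebra_simps)
      have J: "set J \<subseteq> small s" "length J \<le> length ts" "size (enc_list enc_nat J) < K"
        unfolding J_def using due_small[OF assms(2)] due_bounds(1)[of m 1 ts]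
          size_enc_due_less[OF assms(2) order_refl l] by auto
      have "K ^ 3 \<le> K ^ 4" by (cases "K = 0") (simp_all add: power_increasing)
      then have Du: "call fDue [enc_nat m, Node (Node Leaf Leaf) Leaf, enc_list enc_nat ts]
          (enc_list enc_nat J) (60 * K ^ 4)"
        using call_weaken[OF call_Due[OF 1(2) assms(1) l assms(3,2)]] by (simp add: J_def enc_nat_pos)
      have "(length J + length D) * (s + 1) \<le> (length ts + length D) * (s + 1)"
        using J(2) by (intro mult_le_mono1) simp
      then have T: "call fTour [enc_pairs D, enc_list enc_nat J] (enc_pairs (tour D J)) (140 * K ^ 4)"
        using assms J by (intro call_Tour[where s = s]) auto
      have IH: "call fRules [enc_nat (m div 2), enc_pairs D, enc_list enc_nat ts]
        (enc_rules (rules (m div 2) D ts)) (Suc (bitlen (m div 2)) * (230 * K ^ 4))"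
        using 1 False by (intro 1(1)) (auto simp: enc)
      have R: "enc_rules (rules m D ts) = Node (Node Leaf (Node (enc_nat m)
        (Node (enc_pairs (tour D J)) (enc_list enc_nat J)))) (enc_rules (rules (m div 2) D ts))"
        using m by (subst rules.simps) (simp add: J_def)
      from 1(2) J(3) assms(3,4) le_power(3)[of K] show ?thesis unfolding R bitlen_pos[OF m]
        by - (rule callI, simp add: index_less,
        simp add: sched_prog_nth body_Rules_def,
          (rule evb_intros evb_Vars[where K=K] Du T IH | simp add: enc | simp add: enc[symmetric])+)
    qed
  qed
qed

text \<open>For input size \<open>S\<close>, the crude bound on the tree is \<open>S\<close> sweeps
  adding \<open>S\<close> arcs each, and an arc has a code of size linear in \<open>S\<close>; hence
  the cubic \<open>K\<close>.\<close>

lemma runs_solve: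
  assumes "\<forall>(u, v, w)\<in>set (fst I). u \<le> length (snd I) \<and> v \<le> length (snd I)"
  defines "K \<equiv> 12 * (size (enc_input I) + 2) ^ 3"
  shows "\<exists>t. runs sched_prog (enc_input I) (enc_schedule (solve I)) t \<and> t \<le> 600 * K ^ 5"
proof -
  obtain E ts where I: "I = (E, ts)" by (cases I)
  define S where "S = size (enc_input I)"
  \<comment> \<open>Vertex numbers are at most \<open>length ts\<close>, hence below
    \<open>S\<close>, and a code is at most twice as large as the number.\<close>
  define s where "s = 2 * S + 2"
  define D where "D = spanning 0 (length ts) E"
  define M :: nat where "M = 2 ^ sum_list (map bitlen ts)"
  have enc: "enc_input I = Node (enc_edges E) (enc_list enc_nat ts)"
    by (simp add: I enc_input_def)
  have S: "size (enc_edges E) < S" "size (enc_list enc_nat ts) < S" "length E < S" "length ts < S"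
    using length_le_size_enc_list[of E "enc_prod enc_nat (enc_prod enc_nat enc_rat)"]
      length_le_size_enc_list[of ts enc_nat] by (auto simp: S_def enc)
  have K: "K = 12 * (S * S * S) + 72 * (S * S) + 144 * S + 96"
    by (simp add: K_def S_def[symmetric] power3_eq_cube algebra_simps)
  have sK: "s < K" by (simp add: s_def K)
  have EK: "size (enc_edges E) < K" "size (enc_list enc_nat ts) + 2 < K" "size (enc_input I) < K"
    using S by (simp_all add: K S_def[symmetric])
  have small: "x \<in> small s" if "x \<le> length ts" for x
    using size_enc_nat_le[of x] that S by (simp add: small_def s_def)
  have Es: "\<forall>(u, v, w)\<in>set E. u \<in> small s \<and> v \<in> small s"
    using assms(1) small by (auto simp: I)
  have Dl: "length D \<le> length ts * length E"
    by (simp add: D_def span_bounds)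
  also have DS: "length ts * length E \<le> S * S"
    using S by (intro mult_le_mono) auto
  finally have D2: "length D \<le> S * S" .
  have "length D * (s + 1) \<le> S * S * (s + 1)" "length D * (2 * s + 2) \<le> S * S * (2 * s + 2)"
    "length ts * length E * (2 * s + 2) \<le> S * S * (2 * s + 2)" "length ts * (s + 1) \<le> S * (s + 1)"
    using D2 DS S(4) by (intro mult_le_mono1; simp)+
  then have DK: "2 * length D * (2 * s + 2) < K" "(length ts + length D) * (s + 1) < K"
    "length ts * length E * (2 * s + 2) < K" "2 * (1 + length ts) \<le> s"
    using S(4) by (simp_all add: s_def K algebra_simps)
  have Ds: "set D \<subseteq> small s \<times> small s"
    unfolding D_def by (rule order_trans[OF span_bounds(2)]) (use Es in auto)
  have DKs: "size (enc_pairs D) < K"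
    using size_enc_pairs[OF Ds] DK(1) by simp
  have Sp: "call fSpan [enc_list enc_nat ts, enc_edges E] (enc_pairs D) (180 * K ^ 5)"
    unfolding D_def using EK by (intro call_Span[OF sK EK(1) Es _ DK(3)]) simp
  have 35: "K ^ 3 \<le> K ^ 5" "K \<le> K ^ 5" "1 \<le> K ^ 5"
    using sK by (auto intro: power_increasing self_le_power)
  have P: "call fPeriod [enc_list enc_nat ts] (enc_nat M) (40 * K ^ 5)"
    unfolding M_def by (rule call_weaken[OF call_Period[OF EK(2)]]) (use 35 in simp)
  have MK: "size (enc_nat M) < K"
    using EK(2) sum_bitlen_le_size[of ts] by (simp add: M_def size_enc_nat_power)
  note R = call_Rules[OF sK DK(4) _ DKs Ds DK(1,2) MK]
  have sol: "enc_schedule (solve I) = Node (enc_nat M) (enc_rules (rules M D ts))"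
    by (simp add: enc_schedule_def solve_def I M_def D_def Let_def)
  have "call fMain [enc_input I] (enc_schedule (solve I)) (500 * K ^ 5)"
    unfolding sol using EK DKs MK 35(2) unfolding enc
    by - (rule callI, simp add: index_less,
        simp add: sched_prog_nth body_Main_def,
      (rule evb_intros evb_Vars[where K=K] Sp P R | simp)+)
  then have "evb [enc_input I] (ECall fMain [EVar 0]) (enc_schedule (solve I)) (K + 0 + 500 * K ^ 5 + 1)"
    by (rule evb_Call[OF evbs_Cons[OF evb_Vars(1)[OF EK(3)] evbs_Nil]])
  then obtain t where "t \<le> K + 0 + 500 * K ^ 5 + 1" "runs sched_prog (enc_input I) (enc_schedule (solve I)) t"
    unfolding evb_def runs_def fMain_def by blast
  then show ?thesis
    using 35 by (intro exI[of _ t]) auto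
qed


section \<open>Tours in trees\<close>

text \<open>Otherwise a path from \<open>x\<close> to \<open>y\<close> avoiding the arc, closed up
  by \<open>(y, x)\<close>, would be a cycle. Its length is at least 3, because a path with a single
  arc would be \<open>(x, y)\<close> itself.\<close>

lemma (in rftt_tree) edge_is_bridge:
  assumes arc: "(x, y) \<in> parcs G" and walk: "awalk x p y"
  shows "(x, y) \<in> set p"
proof (rule ccontr)
  assume notin: "(x, y) \<notin> set p"
  define q where "q = awalk_to_apath p"
  have path: "apath x q y" and q: "set q \<subseteq> set p"
    using walk unfolding q_def by (auto intro: apath_awalk_to_apath awalk_to_apath_subset[THEN subsetD])
  then have q_walk: "awalk x q y" and dist: "distinct (awalk_verts x q)"
    by (auto simp: apath_def)
  have "x \<noteq> y" using arc no_loops by fastforce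
  have yx: "(y, x) \<in> parcs G" using arc by (rule arcs_symmetric)
  have "2 \<le> length q"
  proof (rule ccontr)
    assume "\<not> 2 \<le> length q"
    then consider "q = []" | e where "q = [e]" by (cases q) (auto simp: Suc_le_eq)
    then show False
      using q_walk \<open>x \<noteq> y\<close> notin q by cases (auto simp: awalk_simps)
  qed
  moreover have "cycle (q @ [(y, x)])"
  proof -
    have walk': "awalk x (q @ [(y, x)]) x"
      using q_walk yx in_arcsD1[OF arc] by (auto simp: awalk_simps)
    have "awalk_verts x (q @ [(y, x)]) = awalk_verts x q @ [x]"
      using awalk_verts_append[OF walk'] q_walk by simp
    moreover have "awalk_verts x q = x # tl (awalk_verts x q)"
      by (cases q) (use q_walk in \<open>auto simp: awalk_simps\<close>)
    ultimately have "distinct (tl (awalk_verts x (q @ [(y, x)])))"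
      using dist by (metis append_Cons distinct.simps(2) distinct_append distinct_singleton
          disjoint_insert(1) empty_set inf_bot_right inf_commute list.sel(3) list.simps(15))
    then show ?thesis using walk' unfolding cycle_def by blast
  qed
  ultimately show False using acyclic by fastforce
qed

section \<open>Rooted trees as lists of arcs\<close>

lemma set_rev_path: "set (rev_path p) = (set p)\<inverse>"
  by (induction p) auto

text \<open>An out-tree with root \<open>r\<close> in its order of growth: the head of the list ends
  in a leaf, so induction on the list removes leaves.\<close>

fun grown :: "'a \<Rightarrow> ('a \<times> 'a) list \<Rightarrow> bool" where
  "grown r [] = True"
| "grown r ((u, v) # D) = (u \<in> visited r D \<and> v \<notin> visited r D \<and> grown r D)"

lemma grown_endpoints: "grown r D \<Longrightarrow> (u, v) \<in> set D \<Longrightarrow> u \<in> visited r D \<and> v \<in> visited r D \<and> v \<noteq> r"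
  by (induction r D rule: grown.induct) (auto simp: visited_def)

lemma grown_asym: "grown r D \<Longrightarrow> (u, v) \<in> set D \<Longrightarrow> (v, u) \<notin> set D"
proof (induction r D rule: grown.induct)
  case (2 r a b D)
  then show ?case using grown_endpoints[of r D] by (auto simp: visited_def)
qed auto

context rftt
begin

lemma grown_walk_up:
  "grown s D \<Longrightarrow> set D \<subseteq> parcs G \<Longrightarrow> x \<in> visited s D \<Longrightarrow> \<exists>p. awalk x p s \<and> set p \<subseteq> (set D)\<inverse>"
proof (induction D arbitrary: x)
  case Nil
  then show ?case using depot by (auto simp: awalk_Nil_iff intro!: exI[of _ "[]"])
next
  case (Cons e D)
  obtain u v where e: "e = (u, v)" by (cases e)
  show ?case
  proof (cases "x \<in> visited s D")
    case True
    then show ?thesis using Cons by (fastforce simp: e)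
  next
    case False
    with Cons.prems have x: "x = v" by (auto simp: e)
    obtain p where "awalk u p s" "set p \<subseteq> (set D)\<inverse>"
      using Cons.IH[of u] Cons.prems by (auto simp: e)
    then have "awalk x ((v, u) # p) s" "set ((v, u) # p) \<subseteq> (set (e # D))\<inverse>"
      using Cons.prems by (auto simp: e x awalk_Cons_iff arcs_symmetric)
    then show ?thesis by blast
  qed
qed

lemma walk_down:
  assumes "set D \<subseteq> parcs G" "v \<in> pverts G" "(v, j) \<in> (set D)\<^sup>*"
  shows "\<exists>p. awalk v p j \<and> set p \<subseteq> set D"
  using assms(3)
proof (induction rule: rtrancl_induct)
  case base
  then show ?case using assms(2) by (auto simp: awalk_Nil_iff intro!: exI[of _ "[]"])
next
  case (step y z)
  then obtain p where p: "awalk v p y" "set p \<subseteq> set D" by blast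
  have "awalk y [(y, z)] z" using step(2) assms(1) by (auto simp: awalk_simps dest: in_arcsD1 in_arcsD2)
  then have "awalk v (p @ [(y, z)]) z" using p(1) by (rule awalk_appendI[rotated])
  then show ?case using p(2) step(2) by (intro exI[of _ "p @ [(y, z)]"]) auto
qed

lemma awalk_detour:
  assumes "(p, v) \<in> parcs G"
  shows "awalk u T w \<Longrightarrow> p \<in> set (awalk_verts u T) \<Longrightarrow>
    awalk u (detour p v T) w \<and> set (awalk_verts u (detour p v T)) = insert v (set (awalk_verts u T))"
proof (induction T arbitrary: u)
  case Nil
  then show ?case
    using assms arcs_symmetric[OF assms] by (auto simp: awalk_simps detour.simps dest: in_arcsD1 in_arcsD2)
next
  case (Cons e T)
  then show ?case
    using assms arcs_symmetric[OF assms] by (cases e) (auto simp: awalk_simps detour.simps)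
qed

end

lemma set_detour: "set (detour p v T) = {(p, v), (v, p)} \<union> set T"
proof (induction T)
  case (Cons e T)
  then show ?case by (cases e) (simp add: detour.simps insert_commute)
qed (simp add: detour.simps)

lemma distinct_detour:
  "distinct T \<Longrightarrow> (p, v) \<notin> set T \<Longrightarrow> (v, p) \<notin> set T \<Longrightarrow> p \<noteq> v \<Longrightarrow> distinct (detour p v T)"
proof (induction T)
  case (Cons e T)
  then show ?case by (cases e) (auto simp: detour.simps set_detour)
qed (simp add: detour.simps)

text \<open>The arcs of the tree \<open>D\<close> on the paths from its root to the vertices of \<open>X\<close>.\<close>

definition arcs_above :: "('a \<times> 'a) list \<Rightarrow> 'a set \<Rightarrow> ('a \<times> 'a) set" where
  "arcs_above D X = {e \<in> set D. \<exists>j\<in>X. (snd e, j) \<in> (set D)\<^sup>*}"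

lemma above_Cons_mono: "arcs_above D X \<subseteq> arcs_above (e # D) X"
  unfolding arcs_above_def using rtrancl_mono[of "set D" "set (e # D)"] by auto

text \<open>Marking the parent \<open>p\<close> demands nothing new: an arc above \<open>p\<close>
  is also above \<open>v\<close>, through the arc \<open>(p, v)\<close>. The inclusion is what the
  upper bound on the cost uses.\<close>

lemma set_tour: "set (tour D N) \<subseteq> arcs_above D (set N) \<union> (arcs_above D (set N))\<inverse>"
proof (induction D arbitrary: N)
  case (Cons e D)
  obtain p v where e: "e = (p, v)" by (cases e)
  show ?case
  proof (cases "v \<in> set N")
    case True
    have "arcs_above D (set (p # N)) \<subseteq> arcs_above (e # D) (set N)"
    proof
      fix x assume "x \<in> arcs_above D (set (p # N))"
      then obtain j where j: "x \<in> set D" "j \<in> set (p # N)" "(snd x, j) \<in> (set D)\<^sup>*"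
        by (auto simp: arcs_above_def)
      have sub: "(snd x, j) \<in> (set (e # D))\<^sup>*"
        using j(3) rtrancl_mono[of "set D" "set (e # D)"] by auto
      then have "(snd x, v) \<in> (set (e # D))\<^sup>*" if "j = p"
        using that by (auto simp: e intro: rtrancl_into_rtrancl)
      with sub j True show "x \<in> arcs_above (e # D) (set N)"
        by (auto simp: arcs_above_def)
    qed
    moreover have "e \<in> arcs_above (e # D) (set N)"
      using True by (auto simp: arcs_above_def e)
    ultimately show ?thesis
      using Cons.IH[of "p # N"] True by (auto simp: tour.simps e set_detour)
  next
    case False
    then show ?thesis using Cons.IH[of N] above_Cons_mono[of D "set N" e] by (auto simp: tour.simps e)
  qed
qed (simp add: tour.simps)

lemma above_subset: "arcs_above D X \<subseteq> set D"
  by (auto simp: arcs_above_def)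

text \<open>The vertex \<open>v\<close> is new to the tree \<open>D\<close>, so neither arc of the
  detour to it occurs in a tour built from \<open>D\<close>. Distinctness turns the cost of a tour
  into a sum over a set.\<close>

lemma distinct_tour: "grown r D \<Longrightarrow> distinct (tour D N)"
proof (induction D arbitrary: N)
  case (Cons e D)
  obtain p v where e: "e = (p, v)" by (cases e)
  have "(p, v) \<notin> set (tour D M)" "(v, p) \<notin> set (tour D M)" for M
  proof -
    have "v \<notin> visited r D" "grown r D" using Cons.prems by (simp_all add: e)
    moreover have "set (tour D M) \<subseteq> set D \<union> (set D)\<inverse>"
      using set_tour[of D M] above_subset[of D "set M"] by blast
    ultimately show "(p, v) \<notin> set (tour D M)" "(v, p) \<notin> set (tour D M)"
      using grown_endpoints[of r D] by blast+
  qed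
  moreover have "p \<noteq> v" using Cons.prems by (auto simp: e)
  ultimately show ?case using Cons by (auto simp: tour.simps e intro: distinct_detour)
qed (simp add: tour.simps)

text \<open>Since \<open>p\<close> is added to the needed vertices, the tour of the smaller tree
  passes through \<open>p\<close>, and the detour to \<open>v\<close> can be inserted there.\<close>

lemma (in rftt) awalk_tour:
  "grown s D \<Longrightarrow> set D \<subseteq> parcs G \<Longrightarrow>
    awalk s (tour D N) s \<and> set N \<inter> visited s D \<subseteq> set (awalk_verts s (tour D N))"
proof (induction D arbitrary: N)
  case Nil
  then show ?case using depot by (auto simp: tour.simps awalk_Nil_iff)
next
  case (Cons e D)
  obtain p v where e: "e = (p, v)" by (cases e)
  show ?case
  proof (cases "v \<in> set N")
    case True
    have IH: "awalk s (tour D (p # N)) s" "set (p # N) \<inter> visited s D \<subseteq> set (awalk_verts s (tour D (p # N)))"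
      using Cons.IH[of "p # N"] Cons.prems by (auto simp: e)
    have pv: "p \<in> visited s D" "(p, v) \<in> parcs G" using Cons.prems by (simp_all add: e)
    have "p \<in> set (awalk_verts s (tour D (p # N)))"
      using IH(2) pv(1) by (meson IntI list.set_intros(1) subsetD)
    from awalk_detour[OF pv(2) IH(1) this] IH(2) True show ?thesis
      by (simp add: tour.simps e) blast
  next
    case False
    then show ?thesis using Cons by (auto simp: tour.simps e)
  qed
qed

context rftt_tree
begin

text \<open>Extending a walk from \<open>s\<close> to \<open>j\<close> by tree arcs towards \<open>s\<close> yields a walk from \<open>p\<close> to \<open>v\<close>,
  which crosses the bridge; the added arcs are not \<open>(p, v)\<close>, so the original walk contains it.\<close>

lemma closed_walk_crosses:
  assumes D: "grown s D" "set D \<subseteq> parcs G" and pv: "(p, v) \<in> set D" "(v, j) \<in> (set D)\<^sup>*"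
    and W: "awalk s W s" "j \<in> set (awalk_verts s W)"
  shows "(p, v) \<in> set W" "(v, p) \<in> set W"
proof -
  obtain W1 W2 where W12: "W = W1 @ W2" "awalk s W1 j" "awalk j W2 s"
    using awalk_decomp[OF W] by blast
  obtain U where U: "awalk p U s" "set U \<subseteq> (set D)\<inverse>"
    using grown_walk_up[OF D, of p] grown_endpoints[OF D(1) pv(1)] by blast
  have arc: "(p, v) \<in> parcs G" using pv(1) D(2) by blast
  obtain Q where Q: "awalk v Q j" "set Q \<subseteq> set D"
    using walk_down[OF D(2) in_arcsD2[OF arc] pv(2)] by blast
  have vp: "(v, p) \<notin> set D" using grown_asym[OF D(1) pv(1)] .
  have "awalk p (U @ W1 @ rev_path Q) v"
    using U W12 Q by (auto intro!: awalk_appendI)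
  from edge_is_bridge[OF arc this] show "(p, v) \<in> set W"
    using U(2) Q(2) vp W12 by (auto simp: set_rev_path)
  have "awalk v (Q @ W2 @ rev_path U) p"
    using U W12 Q by (auto intro!: awalk_appendI)
  from edge_is_bridge[OF arcs_symmetric[OF arc] this] show "(v, p) \<in> set W"
    using U(2) Q(2) vp W12 by (auto simp: set_rev_path)
qed

text \<open>A grown tree never contains an arc together with its reverse, and both have the same
  weight.\<close>

lemma sum_above_inverse:
  assumes D: "grown s D" "set D \<subseteq> parcs G"
  shows "sum c (arcs_above D X \<union> (arcs_above D X)\<inverse>) = (\<Sum>e\<in>arcs_above D X. 2 * c e)"
proof -
  have F: "arcs_above D X \<subseteq> set D" "finite (arcs_above D X)"
    using above_subset finite_subset[OF above_subset] by auto
  have "(arcs_above D X) \<inter> (arcs_above D X)\<inverse> = {}"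
    using F(1) grown_asym[OF D(1)] by auto
  then have "sum c (arcs_above D X \<union> (arcs_above D X)\<inverse>) = sum c (arcs_above D X) + sum c ((arcs_above D X)\<inverse>)"
    using F(2) by (simp add: sum.union_disjoint)
  also have "sum c ((arcs_above D X)\<inverse>) = sum c (arcs_above D X)"
    by (rule sum.reindex_bij_witness[of _ prod.swap prod.swap]) (use F(1) D(2) weight_sym in auto)
  finally show ?thesis by (simp add: sum_distrib_left)
qed

lemma cost_tour_le:
  assumes D: "grown s D" "set D \<subseteq> parcs G"
  shows "awalk_cost c (tour D N) \<le> (\<Sum>e\<in>arcs_above D (set N). 2 * c e)"
proof -
  have "awalk_cost c (tour D N) = sum c (set (tour D N))"
    using distinct_tour[OF D(1)] by (simp add: awalk_cost_def sum_list_distinct_conv_sum_set)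
  also have "\<dots> \<le> sum c (arcs_above D (set N) \<union> (arcs_above D (set N))\<inverse>)"
  proof (rule sum_mono2[OF _ set_tour])
    show "finite (arcs_above D (set N) \<union> (arcs_above D (set N))\<inverse>)"
      using finite_subset[OF above_subset] by auto
    show "0 \<le> c b" if "b \<in> arcs_above D (set N) \<union> (arcs_above D (set N))\<inverse> - set (tour D N)" for b
      using that above_subset[of D "set N"] D(2) by (intro weight_nonneg) (auto intro: arcs_symmetric)
  qed
  finally show ?thesis using sum_above_inverse[OF D] by simp
qed

text \<open>Matches the upper bound of \<open>cost_tour_le\<close>: any closed walk visiting
  \<open>X\<close> crosses each of these arcs in both directions, so the tours constructed are
  optimal for the clients of the day.\<close>

lemma sum_le_cost:
  assumes D: "grown s D" "set D \<subseteq> parcs G" and W: "awalk s W s" "X \<subseteq> set (awalk_verts s W)"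
  shows "(\<Sum>e\<in>arcs_above D X. 2 * c e) \<le> awalk_cost c W"
proof -
  have "arcs_above D X \<union> (arcs_above D X)\<inverse> \<subseteq> set W"
    using closed_walk_crosses[OF D _ _ W(1)] W(2) by (auto simp: arcs_above_def)
  moreover have nonneg: "0 \<le> c e" if "e \<in> set W" for e
    using that W(1) by (auto simp: awalk_def intro: weight_nonneg)
  ultimately have "sum c (arcs_above D X \<union> (arcs_above D X)\<inverse>) \<le> sum c (set W)"
    by (intro sum_mono2) auto
  \<comment> \<open>Repeated arcs only increase the cost, as weights are nonnegative.\<close>
  also have "\<dots> \<le> sum_list (map c W)"
    using nonneg
  proof (induction W)
    case (Cons e W)
    then show ?case by (cases "e \<in> set W") (fastforce simp: insert_absorb intro: add_increasing)+
  qed simp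
  finally show ?thesis
    using sum_above_inverse[OF D] by (simp add: awalk_cost_def)
qed

end


section \<open>Frequencies of visits\<close>

text \<open>Double counting: a sum over days becomes a sum over edges, weighted by the number of
  days on which they are used.\<close>

lemma sum_incidence:
  fixes g :: "'a \<Rightarrow> real"
  assumes "finite S" "finite K" "\<And>k. F k \<subseteq> S"
  shows "(\<Sum>k\<in>K. \<Sum>e\<in>F k. g e) = (\<Sum>e\<in>S. g e * card {k \<in> K. e \<in> F k})"
proof -
  have "(\<Sum>k\<in>K. \<Sum>e\<in>F k. g e) = (\<Sum>k\<in>K. \<Sum>e\<in>S. if e \<in> F k then g e else 0)"
  proof (rule sum.cong)
    fix k
    have "{e \<in> S. e \<in> F k} = F k" using assms(3) by blast
    then show "(\<Sum>e\<in>F k. g e) = (\<Sum>e\<in>S. if e \<in> F k then g e else 0)"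
      by (simp add: sum.inter_filter[OF assms(1), symmetric])
  qed simp
  also have "\<dots> = (\<Sum>e\<in>S. \<Sum>k\<in>K. if e \<in> F k then g e else 0)"
    by (rule sum.swap)
  also have "\<dots> = (\<Sum>e\<in>S. g e * card {k \<in> K. e \<in> F k})"
    by (simp add: sum.inter_filter[OF assms(2), symmetric] mult.commute)
  finally show ?thesis .
qed

text \<open>Periodicity is assumed from day 1 on, so the blocks of length \<open>l\<close> are
  shifted copies of the days 1 to \<open>l\<close>.\<close>

lemma card_periodic:
  fixes P :: "nat \<Rightarrow> bool"
  assumes "\<And>k. k \<ge> 1 \<Longrightarrow> P (k + l) = P k"
  shows "card {k \<in> {1..m * l}. P k} = m * card {k \<in> {1..l}. P k}"
proof (induction m)
  case (Suc m)
  have shift: "P (k + m * l) = P k" if "k \<ge> 1" for k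
    using that
  proof (induction m)
    case (Suc m)
    then show ?case using assms[of "k + m * l"] by (simp add: algebra_simps)
  qed simp
  have "{k \<in> {1..Suc m * l}. P k} = {k \<in> {1..m * l}. P k} \<union> (\<lambda>k. k + m * l) ` {k \<in> {1..l}. P k}"
  proof (intro equalityI subsetI)
    fix k assume k: "k \<in> {k \<in> {1..Suc m * l}. P k}"
    show "k \<in> {k \<in> {1..m * l}. P k} \<union> (\<lambda>k. k + m * l) ` {k \<in> {1..l}. P k}"
    proof (cases "k \<le> m * l")
      case False
      then have "k - m * l \<in> {k \<in> {1..l}. P k}" "k = (k - m * l) + m * l"
        using k shift[of "k - m * l"] by auto
      then show ?thesis by blast
    qed (use k in auto)
  next
    fix k assume "k \<in> {k \<in> {1..m * l}. P k} \<union> (\<lambda>k. k + m * l) ` {k \<in> {1..l}. P k}"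
    then show "k \<in> {k \<in> {1..Suc m * l}. P k}"
      using shift by auto
  qed
  moreover have "card ((\<lambda>k. k + m * l) ` {k \<in> {1..l}. P k}) = card {k \<in> {1..l}. P k}"
    by (rule card_image) (auto simp: inj_on_def)
  moreover have "{k \<in> {1..m * l}. P k} \<inter> (\<lambda>k. k + m * l) ` {k \<in> {1..l}. P k} = {}"
    by auto
  ultimately show ?case
    using Suc by (simp add: card_Un_disjoint)
qed simp

text \<open>The first \<open>m * d\<close> days split into \<open>m\<close> disjoint windows of
  length \<open>d\<close>, each containing a day with \<open>P\<close>.\<close>

lemma card_windows:
  fixes P :: "nat \<Rightarrow> bool"
  assumes "\<And>t. \<exists>k\<in>{t + 1..t + d}. P k"
  shows "m \<le> card {k \<in> {1..m * d}. P k}"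
proof (induction m)
  case (Suc m)
  obtain k where k: "k \<in> {m * d + 1..m * d + d}" "P k" using assms by blast
  have "Suc m \<le> card (insert k {k \<in> {1..m * d}. P k})"
    using Suc k by (simp add: card_insert_if)
  also have "\<dots> \<le> card {k \<in> {1..Suc m * d}. P k}"
    using k by (intro card_mono) auto
  finally show ?case .
qed simp

lemma card_multiples: "d > 0 \<Longrightarrow> card {k \<in> {1..m * d}. d dvd k} = (m::nat)"
proof -
  assume d: "d > 0"
  have "{k \<in> {1..m * d}. d dvd k} = (\<lambda>i. i * d) ` {1..m}"
  proof (intro equalityI subsetI)
    fix k assume k: "k \<in> {k \<in> {1..m * d}. d dvd k}"
    then obtain i where "k = i * d" by (metis (no_types, lifting) dvd_def mem_Collect_eq mult.commute)
    with k d show "k \<in> (\<lambda>i. i * d) ` {1..m}" by (auto simp: Suc_le_eq)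
  qed (use d in auto)
  then show ?thesis using d by (simp add: card_image inj_on_def)
qed

text \<open>The exponent of the largest power of 2 that divides \<open>k\<close>, capped at \<open>A\<close>.\<close>

fun level :: "nat \<Rightarrow> nat \<Rightarrow> nat" where
  "level 0 k = 0"
| "level (Suc A) k = (if 2 ^ Suc A dvd k then Suc A else level A k)"

lemma level_le: "level A k \<le> A"
  by (induction A) auto

lemma level_dvd: "2 ^ level A k dvd k"
  by (induction A) auto

lemma le_level: "2 ^ b dvd k \<Longrightarrow> b \<le> A \<Longrightarrow> b \<le> level A k"
  by (induction A) (auto simp: le_Suc_eq)

lemma level_add: "A \<le> B \<Longrightarrow> level A (k + 2 ^ B) = level A k"
proof (induction A)
  case (Suc A)
  have "2 ^ Suc A dvd (2::nat) ^ B" using Suc.prems by (rule le_imp_power_dvd)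
  then have "2 ^ Suc A dvd k + 2 ^ B \<longleftrightarrow> 2 ^ Suc A dvd k" by (rule dvd_add_left_iff)
  with Suc show ?case by simp
qed simp

lemma ex_power2_interval: "1 \<le> (n::nat) \<Longrightarrow> \<exists>f. 2 ^ f \<le> n \<and> n < 2 ^ Suc f"
proof (induction n rule: less_induct)
  case (less n)
  show ?case
  proof (cases "n = 1")
    case False
    with less.prems have "1 \<le> n div 2" "n div 2 < n" by presburger+
    then obtain f where "2 ^ f \<le> n div 2" "n div 2 < 2 ^ Suc f" using less.IH by blast
    then have "2 ^ Suc f \<le> n" "n < 2 ^ Suc (Suc f)" by auto
    then show ?thesis by blast
  qed (auto intro: exI[of _ 0])
qed

section \<open>The approximation factor\<close>

context rftt_tree
begin

text \<open>Both frequencies are compared with the least turnover time \<open>\<tau> j0\<close> beyond the arc \<open>e\<close>: ours is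
  at most \<open>1 / 2 ^ f\<close>, where \<open>2 ^ f\<close> is \<open>\<tau> j0\<close> rounded down, any other one at least \<open>1 / \<tau> j0\<close>.\<close>

lemma edge_rate:
  assumes D: "set D \<subseteq> parcs G" "grown s D" and e: "e \<in> set D"
    and A: "\<And>v. v \<in> clients \<Longrightarrow> \<tau> v < 2 ^ Suc A"
    and J: "\<And>k. k \<ge> 1 \<Longrightarrow> J k = {v \<in> clients. \<tau> v < 2 ^ Suc (level A k)}"
    and opt: "feasible T' J'" "periodic l T' J'"
  shows "card {k \<in> {1..2 ^ A}. e \<in> arcs_above D (J k)} * l \<le> 2 * card {k \<in> {1..l}. e \<in> arcs_above D (J' k)} * 2 ^ A"
proof -
  define B where "B = {j \<in> clients. (snd e, j) \<in> (set D)\<^sup>*}"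
  have "finite B" unfolding B_def clients_def using pair_finite_verts by simp
  moreover have "snd e \<in> B"
    using e D grown_endpoints[OF D(2), of "fst e" "snd e"] by (auto simp: B_def clients_def dest: in_arcsD2)
  ultimately obtain j0 where j0: "j0 \<in> B" "\<And>j. j \<in> B \<Longrightarrow> \<tau> j0 \<le> \<tau> j"
    using ex_min_if_finite[of "\<tau> ` B"] by (metis (no_types, lifting) empty_iff finite_imageI image_iff image_is_empty not_less)
  have j0c: "j0 \<in> clients" using j0(1) by (simp add: B_def)
  then have "1 \<le> \<tau> j0" using turnover_pos by (simp add: clients_def)
  then obtain f where f: "2 ^ f \<le> \<tau> j0" "\<tau> j0 < 2 ^ Suc f" using ex_power2_interval by blast
  have "(2::nat) ^ f < 2 ^ Suc A" using f(1) A[OF j0c] by (rule le_less_trans)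
  then have fA: "f \<le> A" by (simp only: power_strict_increasing_iff less_Suc_eq_le)
  have pow: "(2::nat) ^ A = 2 ^ (A - f) * 2 ^ f" using fA by (simp add: power_add[symmetric])
  \<comment> \<open>A day on which \<open>e\<close> is used serves a client beyond \<open>e\<close>;
    its turnover time is at least \<tau> \<open>j0\<close> and thus at least \<open>2 ^ f\<close>,
    so that the day is a multiple of \<open>2 ^ f\<close>.\<close>
  have "card {k \<in> {1..2 ^ A}. e \<in> arcs_above D (J k)} \<le> card {k \<in> {1..2 ^ (A - f) * 2 ^ f}. (2::nat) ^ f dvd k}"
  proof (rule card_mono)
    show "{k \<in> {1..2 ^ A}. e \<in> arcs_above D (J k)} \<subseteq> {k \<in> {1..2 ^ (A - f) * 2 ^ f}. 2 ^ f dvd k}"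
    proof
      fix k assume "k \<in> {k \<in> {1..2 ^ A}. e \<in> arcs_above D (J k)}"
      then have k: "k \<in> {1..2 ^ A}" "e \<in> arcs_above D (J k)" by auto
      then obtain j where "j \<in> B" "\<tau> j < 2 ^ Suc (level A k)"
        by (auto simp: arcs_above_def J B_def)
      then have "(2::nat) ^ f < 2 ^ Suc (level A k)"
        using f(1) j0(2)[of j] by (meson le_less_trans)
      then have "f \<le> level A k" by (simp only: power_strict_increasing_iff less_Suc_eq_le)
      then have "2 ^ f dvd k" using level_dvd[of A k] by (meson le_imp_power_dvd dvd_trans)
      then show "k \<in> {k \<in> {1..2 ^ (A - f) * 2 ^ f}. 2 ^ f dvd k}" using k(1) by (simp add: pow)
    qed
  qed simp
  also have "\<dots> = 2 ^ (A - f)" by (rule card_multiples) simp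
  finally have ours: "card {k \<in> {1..2 ^ A}. e \<in> arcs_above D (J k)} \<le> 2 ^ (A - f)" .
  define b where "b = card {k \<in> {1..l}. j0 \<in> J' k}"
  \<comment> \<open>The first \<open>l * \<tau> j0\<close> days consist both of \<open>l\<close>
    windows of length \<open>\<tau> j0\<close>, each with a visit to \<open>j0\<close>, and of
    \<open>\<tau> j0\<close> full periods, each with \<open>b\<close> visits.\<close>
  have "l \<le> card {k \<in> {1..l * \<tau> j0}. j0 \<in> J' k}"
    using opt(1) j0c by (intro card_windows) (auto simp: feasible_def)
  also have "\<dots> = \<tau> j0 * b"
    using opt(2) card_periodic[of "\<lambda>k. j0 \<in> J' k" l "\<tau> j0"]
    by (simp add: b_def periodic_def mult.commute)
  finally have l: "l \<le> \<tau> j0 * b" .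
  have theirs: "b \<le> card {k \<in> {1..l}. e \<in> arcs_above D (J' k)}"
    unfolding b_def by (rule card_mono) (use j0(1) e in \<open>auto simp: arcs_above_def B_def\<close>)
  have "card {k \<in> {1..2 ^ A}. e \<in> arcs_above D (J k)} * l \<le> 2 ^ (A - f) * (\<tau> j0 * b)"
    using ours l by (rule mult_le_mono)
  \<comment> \<open>Here the factor 2 arises: rounding down to \<open>2 ^ f\<close> loses less than
    a factor of 2.\<close>
  also have "\<dots> \<le> 2 ^ (A - f) * (2 ^ Suc f * b)"
    using f(2) by (intro mult_le_mono le_refl) simp
  also have "\<dots> = 2 * b * 2 ^ A" by (simp add: pow)
  also have "\<dots> \<le> 2 * card {k \<in> {1..l}. e \<in> arcs_above D (J' k)} * 2 ^ A"
    using theirs by simp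
  finally show ?thesis .
qed

text \<open>The average of the schedule is at most, and that of the other solution at least, the sum
  of \<open>2 * c e\<close> times the frequency with which \<open>e\<close> is used;
  \<open>edge_rate\<close> compares the frequencies edge by edge.\<close>

lemma avg_le:
  assumes D: "set D \<subseteq> parcs G" "grown s D"
    and A: "\<And>v. v \<in> clients \<Longrightarrow> \<tau> v < 2 ^ Suc A"
    and T: "\<And>k. k \<ge> 1 \<Longrightarrow> T k = tour D (N k)"
    and N: "\<And>k. k \<ge> 1 \<Longrightarrow> set (N k) = {v \<in> clients. \<tau> v < 2 ^ Suc (level A k)}"
    and opt: "feasible T' J'" "periodic l T' J'"
  shows "avg_length (2 ^ A) T \<le> 2 * avg_length l T'"
proof -
  have l: "l \<ge> 1" using opt(2) by (simp add: periodic_def)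
  have nonneg: "0 \<le> c e" if "e \<in> set D" for e using that D(1) by (auto intro: weight_nonneg)
  let ?a = "\<lambda>e. card {k \<in> {1..2 ^ A}. e \<in> arcs_above D (set (N k))}"
  let ?b = "\<lambda>e. card {k \<in> {1..l}. e \<in> arcs_above D (J' k)}"
  have "(\<Sum>k=1..2 ^ A. awalk_cost c (T k)) \<le> (\<Sum>k=1..2 ^ A. \<Sum>e\<in>arcs_above D (set (N k)). 2 * c e)"
    by (intro sum_mono) (use T cost_tour_le[OF D(2,1)] in auto)
  also have "\<dots> = (\<Sum>e\<in>set D. 2 * c e * ?a e)"
    by (rule sum_incidence) (auto simp: above_subset)
  finally have ours: "(\<Sum>k=1..2 ^ A. awalk_cost c (T k)) \<le> (\<Sum>e\<in>set D. 2 * c e * ?a e)" .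
  have "(\<Sum>e\<in>set D. 2 * c e * ?b e) = (\<Sum>k=1..l. \<Sum>e\<in>arcs_above D (J' k). 2 * c e)"
    by (rule sum_incidence[symmetric]) (auto simp: above_subset)
  also have "\<dots> \<le> (\<Sum>k=1..l. awalk_cost c (T' k))"
    by (intro sum_mono sum_le_cost[OF D(2,1)]) (use opt(1) in \<open>auto simp: feasible_def\<close>)
  finally have theirs: "(\<Sum>e\<in>set D. 2 * c e * ?b e) \<le> (\<Sum>k=1..l. awalk_cost c (T' k))" .
  have "(\<Sum>e\<in>set D. 2 * c e * ?a e) / 2 ^ A = (\<Sum>e\<in>set D. 2 * c e * (?a e / 2 ^ A))"
    by (simp add: sum_divide_distrib)
  also have "\<dots> \<le> (\<Sum>e\<in>set D. 2 * c e * (2 * (?b e / l)))"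
  proof (intro sum_mono mult_left_mono)
    fix e assume e: "e \<in> set D"
    have "real (?a e * l) \<le> real (2 * ?b e * 2 ^ A)"
      using edge_rate[OF D e A N opt] by (simp only: of_nat_le_iff)
    then have "real (?a e) * real l \<le> 2 * real (?b e) * 2 ^ A" by simp
    then show "?a e / 2 ^ A \<le> 2 * (?b e / l)"
      using l by (simp add: field_simps)
    show "0 \<le> 2 * c e" using nonneg[OF e] by simp
  qed
  also have "\<dots> = 2 * ((\<Sum>e\<in>set D. 2 * c e * ?b e) / l)"
    by (simp add: sum_divide_distrib sum_distrib_left mult_ac)
  finally have "(\<Sum>e\<in>set D. 2 * c e * ?a e) / 2 ^ A \<le> 2 * ((\<Sum>e\<in>set D. 2 * c e * ?b e) / l)" .
  moreover have "avg_length (2 ^ A) T \<le> (\<Sum>e\<in>set D. 2 * c e * ?a e) / 2 ^ A"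
    unfolding avg_length_def using ours by (simp add: divide_right_mono)
  moreover have "(\<Sum>e\<in>set D. 2 * c e * ?b e) / l \<le> avg_length l T'"
    unfolding avg_length_def using theirs by (simp add: divide_right_mono)
  ultimately show ?thesis by linarith
qed

lemma power_of_two_schedule:
  assumes D: "set D \<subseteq> parcs G" "grown s D" "visited s D = pverts G"
    and A: "\<And>v. v \<in> clients \<Longrightarrow> \<tau> v < 2 ^ Suc A"
    and T: "\<And>k. k \<ge> 1 \<Longrightarrow> T k = tour D (N (level A k))"
    and J: "\<And>k. k \<ge> 1 \<Longrightarrow> J k = set (N (level A k))"
    and N: "\<And>a. a \<le> A \<Longrightarrow> set (N a) = {v \<in> clients. \<tau> v < 2 ^ Suc a}"
  shows "feasible T J" "periodic (2 ^ A) T J" "avg_length (2 ^ A) T \<le> 2 * OPT"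
proof -
  have N': "set (N (level A k)) = {v \<in> clients. \<tau> v < 2 ^ Suc (level A k)}" for k
    by (rule N[OF level_le])
  show feas: "feasible T J"
    unfolding feasible_def
  proof (intro conjI allI impI ballI)
    fix k :: nat assume k: "k \<ge> 1"
    show "awalk s (T k) s" using awalk_tour[OF D(2,1)] T[OF k] by simp
    show "J k \<subseteq> clients" using J[OF k] N' by auto
    then have "J k \<subseteq> visited s D" by (auto simp: D(3) clients_def)
    then show "J k \<subseteq> set (awalk_verts s (T k))"
      using awalk_tour[OF D(2,1), of "N (level A k)"] unfolding T[OF k] J[OF k] by blast
  next
    fix t :: nat and v assume v: "v \<in> clients"
    then have "1 \<le> \<tau> v" using turnover_pos by (simp add: clients_def)
    then obtain f where f: "2 ^ f \<le> \<tau> v" "\<tau> v < 2 ^ Suc f" using ex_power2_interval by blast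
    have "(2::nat) ^ f < 2 ^ Suc A" using f(1) A[OF v] by (rule le_less_trans)
    then have fA: "f \<le> A" by (simp only: power_strict_increasing_iff less_Suc_eq_le)
    \<comment> \<open>The first multiple of \<open>2 ^ f\<close> after day \<open>t\<close>.\<close>
    define k where "k = 2 ^ f * (t div 2 ^ f + 1)"
    have "t < k" "k \<le> t + 2 ^ f"
      unfolding k_def by (simp_all add: dividend_less_times_div)
    then have k: "k \<in> {t + 1..t + \<tau> v}" "k \<ge> 1" using f(1) by auto
    have "f \<le> level A k" by (rule le_level[OF _ fA]) (simp add: k_def)
    then have "(2::nat) ^ Suc f \<le> 2 ^ Suc (level A k)" by (simp add: power_increasing)
    with f(2) have "\<tau> v < 2 ^ Suc (level A k)" by (rule less_le_trans)
    then have "v \<in> J k" using v unfolding J[OF k(2)] N' by blast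
    with k(1) show "v \<in> (\<Union>k\<in>{t + 1..t + \<tau> v}. J k)" by blast
  qed
  show per: "periodic (2 ^ A) T J"
    unfolding periodic_def using T J by (auto simp: level_add)
  \<comment> \<open>The bound against every periodic solution passes to the infimum; the schedule
    itself shows that the set is nonempty.\<close>
  have "avg_length (2 ^ A) T / 2 \<le> OPT"
    unfolding OPT_def
  proof (rule cInf_greatest)
    show "{avg_length l T |l T J. feasible T J \<and> periodic l T J} \<noteq> {}"
      using feas per by blast
    fix x assume "x \<in> {avg_length l T |l T J. feasible T J \<and> periodic l T J}"
    then obtain l T' J' where x: "x = avg_length l T'" "feasible T' J'" "periodic l T' J'" by blast
    have "avg_length (2 ^ A) T \<le> 2 * avg_length l T'"
      by (rule avg_le[OF D(1,2) A T N' x(2,3)])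
    then show "avg_length (2 ^ A) T / 2 \<le> x" by (simp add: x(1))
  qed
  then show "avg_length (2 ^ A) T \<le> 2 * OPT" by simp
qed

end


section \<open>Growing a spanning tree\<close>

lemma attach_grown:
  "grown r D \<Longrightarrow> grown r (attach r u v D)"
  "visited r D \<subseteq> visited r (attach r u v D)"
  "u \<in> visited r D \<or> v \<in> visited r D \<Longrightarrow> {u, v} \<subseteq> visited r (attach r u v D)"
  by (auto simp: attach.simps)

lemma sweep_grown:
  "grown r D \<Longrightarrow> grown r (sweep r E D)"
  "visited r D \<subseteq> visited r (sweep r E D)"
proof (induction E arbitrary: D)
  case (Cons e E)
  obtain u v w where e: "e = (u, v, w)" by (cases e)
  { case 1 then show ?case using Cons(1)[of "attach r u v D"] attach_grown(1)[of r D u v] by (simp add: e) }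
  { case 2 then show ?case using Cons(2)[of "attach r u v D"] attach_grown(2)[of r D u v] by (simp add: e) }
qed auto

text \<open>Visited vertices stay visited, so one end is still present when the edge is processed,
  and the other end is then attached.\<close>

lemma sweep_covers:
  "(u, v, w) \<in> set E \<Longrightarrow> u \<in> visited r D \<or> v \<in> visited r D \<Longrightarrow> {u, v} \<subseteq> visited r (sweep r E D)"
proof (induction E arbitrary: D)
  case (Cons e E)
  obtain a b z where e: "e = (a, b, z)" by (cases e)
  show ?case
  proof (cases "(u, v, w) = e")
    case True
    then show ?thesis
      using attach_grown(3)[of u r D v] sweep_grown(2)[of r "attach r u v D" E] Cons.prems by (auto simp: e)
  next
    case False
    then show ?thesis
      using Cons.IH[of "attach r a b D"] attach_grown(2)[of r D a b] Cons.prems by (auto simp: e)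
  qed
qed simp

lemma grown_span: "grown r (spanning r n E)"
  by (induction n) (auto intro: sweep_grown)

lemma (in rftt) visited_span:
  assumes E: "parcs G = (\<Union>(u, v, w)\<in>set E. {(u, v), (v, u)})" and n: "card (pverts G) \<le> Suc n"
  shows "visited s (spanning s n E) = pverts G"
proof -
  have sub: "visited s (spanning s k E) \<subseteq> pverts G" for k
  proof -
    have "set (spanning s k E) \<subseteq> parcs G" unfolding E by (rule span_bounds(2))
    then show ?thesis using depot in_arcsD2 by (fastforce simp: visited_def)
  qed
  have fin: "finite (visited s (spanning s k E))" for k
    by (simp add: visited_def)
  \<comment> \<open>A sweep that adds no vertex shows that the visited set is closed under arcs; it
    then contains everything reachable from the depot, which is the whole graph.\<close>
  have grows: "visited s D = pverts G \<or> visited s D \<subset> visited s (sweep s E D)"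
    if D: "visited s D \<subseteq> pverts G" for D
  proof (rule ccontr)
    assume *: "\<not> ?thesis"
    then have eq: "visited s (sweep s E D) = visited s D" using sweep_grown(2)[of s D E] by blast
    have closed: "b \<in> visited s D" if "(a, b) \<in> parcs G" "a \<in> visited s D" for a b
    proof -
      have "\<exists>w. (a, b, w) \<in> set E \<or> (b, a, w) \<in> set E" using that(1) unfolding E by auto
      then have "{a, b} \<subseteq> visited s (sweep s E D)"
        using sweep_covers[of _ _ _ E s D] that(2) by blast
      with eq show ?thesis by blast
    qed
    have walk: "x \<in> visited s D" if "awalk y p x" "y \<in> visited s D" for x y p
      using that
    proof (induction p arbitrary: y)
      case (Cons e p)
      then show ?case using closed[of y "snd e"] by (cases e) (auto simp: awalk_simps)
    qed (auto simp: awalk_simps)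
    have "strongly_connected (with_proj G)"
      by (rule symmetric_connected_imp_strongly_connected[OF sym_arcs conn])
    then have "\<exists>p. awalk s p x" if "x \<in> pverts G" for x
      using that depot by (simp add: strongly_connected_def reachable_awalk)
    then have "pverts G \<subseteq> visited s D"
      using walk[of s] by (metis insertI1 subsetI visited_def)
    with D * show False by blast
  qed
  \<comment> \<open>The count starts at 1 because of the root, so \<open>k\<close> sweeps yield more
    than \<open>k\<close> vertices unless all are already reached.\<close>
  have "visited s (spanning s k E) = pverts G \<or> k < card (visited s (spanning s k E))" for k
  proof (induction k)
    case 0
    then show ?case by (simp add: visited_def)
  next
    case (Suc k)
    from grows[OF sub[of k]] show ?case
    proof
      assume "visited s (spanning s k E) = pverts G"
      then show ?thesis using sub[of "Suc k"] sweep_grown(2)[of s "spanning s k E" E] by simp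
    next
      assume less: "visited s (spanning s k E) \<subset> visited s (sweep s E (spanning s k E))"
      then have "card (visited s (spanning s k E)) < card (visited s (spanning s (Suc k) E))"
        using fin[of "Suc k"] by (simp add: psubset_card_mono)
      moreover have "visited s (spanning s k E) \<noteq> pverts G"
        using less sub[of "Suc k"] by auto
      ultimately show ?thesis using Suc by linarith
    qed
  qed
  from this[of n] show ?thesis
    using n card_subset_eq[OF pair_finite_verts sub[of n]] card_mono[OF pair_finite_verts sub[of n]] by linarith
qed

section \<open>Correctness of the rules and of the schedule\<close>

lemma no_longer_power: "no_longer t (2 ^ a) \<longleftrightarrow> t < 2 ^ Suc a"
proof (induction a arbitrary: t)
  case 0
  show ?case by (subst no_longer.simps, subst no_longer.simps) auto
next
  case (Suc a)
  have "no_longer t (2 ^ Suc a) \<longleftrightarrow> t = 0 \<or> no_longer (t div 2) (2 ^ a)"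
    by (subst no_longer.simps) simp
  also have "no_longer (t div 2) (2 ^ a) \<longleftrightarrow> t < 2 ^ Suc (Suc a)"
    by (simp only: Suc power_Suc2[of 2 "Suc a"] div_less_iff_less_mult zero_less_numeral)
  finally show ?case by auto
qed

lemma set_due: "set (due (2 ^ a) i ts) = {j \<in> {i..<i + length ts}. ts ! (j - i) < 2 ^ Suc a}"
proof (induction ts arbitrary: i)
  case (Cons t ts)
  have "{j \<in> {i..<i + length (t # ts)}. (t # ts) ! (j - i) < 2 ^ Suc a} =
    (if t < 2 ^ Suc a then {i} else {}) \<union> {j \<in> {Suc i..<Suc i + length ts}. ts ! (j - Suc i) < 2 ^ Suc a}"
    by (auto simp: nth_Cons' Suc_le_eq le_less split: if_splits)
  then show ?case by (simp add: due.simps no_longer_power Cons.IH del: power_Suc)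
qed (simp add: due.simps)

lemma less_power_bitlen: "n < 2 ^ bitlen n"
proof (induction n rule: bitlen.induct)
  case (1 n)
  show ?case
  proof (cases "n = 0")
    case False
    then show ?thesis using 1 by (simp add: bitlen_pos)
  qed simp
qed

text \<open>All residues are 0, so a rule applies when its modulus divides the day, and the search
  follows the recursion of \<open>level\<close>. The last modulus is 1, which guarantees a
  match.\<close>

lemma find_rules:
  "find (\<lambda>(r, m, T, J). k mod m = r mod m) (rules (2 ^ A) D ts) =
    Some (0, 2 ^ level A k, tour D (due (2 ^ level A k) 1 ts), due (2 ^ level A k) 1 ts)"
proof (induction A)
  case (Suc A)
  have "rules (2 ^ Suc A) D ts = (0, 2 ^ Suc A, tour D (due (2 ^ Suc A) 1 ts), due (2 ^ Suc A) 1 ts) # rules (2 ^ A) D ts"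
    by (subst rules.simps) simp
  then show ?case using Suc by (simp add: dvd_eq_mod_eq_0 del: power_Suc)
qed (simp add: rules.simps[of "Suc 0"] rules.simps[of 0])

lemma solve_correct:
  assumes "tree_input I"
  shows "rftt.feasible (in_graph I) 0 (in_turnover I) (sched_tour (solve I)) (sched_visits (solve I))"
    "rftt.periodic (sched_period (solve I)) (sched_tour (solve I)) (sched_visits (solve I))"
    "rftt.avg_length (in_weight I) (sched_period (solve I)) (sched_tour (solve I))
         \<le> 2 * rftt.OPT (in_graph I) 0 (in_weight I) (in_turnover I)"
proof -
  interpret rftt_tree "in_graph I" 0 "in_weight I" "in_turnover I"
    using assms by (simp add: tree_input_def)
  obtain E ts where I: "I = (E, ts)" by (cases I)
  define D where "D = spanning 0 (length ts) E"
  define A where "A = sum_list (map bitlen ts)"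
  define N where "N a = due (2 ^ a) 1 ts" for a
  have E: "parcs (in_graph I) = (\<Union>(u, v, w)\<in>set E. {(u, v), (v, u)})"
    by (simp add: in_graph_def I)
  have cl: "clients = {1..length ts}"
    unfolding clients_def by (auto simp: in_graph_def I)
  have tau: "in_turnover I v = ts ! (v - 1)" for v
    by (simp add: in_turnover_def I)
  have S: "solve I = (2 ^ A, rules (2 ^ A) D ts)"
    by (simp add: solve_def I A_def D_def Let_def)
  have day: "sched_day (solve I) k = (tour D (N (level A k)), set (N (level A k)))" for k
    unfolding sched_day_def S by (simp add: find_rules N_def)
  have D: "set D \<subseteq> parcs (in_graph I)"
    unfolding D_def E by (rule span_bounds(2))
  have g: "grown 0 D" unfolding D_def by (rule grown_span)
  have vis: "visited 0 D = pverts (in_graph I)"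
    unfolding D_def by (rule visited_span[OF E]) (simp add: in_graph_def I)
  \<comment> \<open>The exponent \<open>A\<close> is the sum of all bit lengths and therefore
    dominates each of them.\<close>
  have A: "in_turnover I v < 2 ^ Suc A" if "v \<in> clients" for v
  proof -
    have "bitlen (ts ! (v - 1)) \<le> A"
      unfolding A_def using that by (intro member_le_sum_list) (auto simp: cl)
    then have "(2::nat) ^ bitlen (ts ! (v - 1)) \<le> 2 ^ Suc A"
      by (intro power_increasing) auto
    then show ?thesis unfolding tau using less_power_bitlen[of "ts ! (v - 1)"] by linarith
  qed
  have N: "set (N a) = {v \<in> clients. in_turnover I v < 2 ^ Suc a}" for a
    unfolding N_def set_due tau cl by auto
  have per: "sched_period (solve I) = 2 ^ A" by (simp add: S)
  note * = power_of_two_schedule[OF D g vis A, of "sched_tour (solve I)" N "sched_visits (solve I)"]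
  show "feasible (sched_tour (solve I)) (sched_visits (solve I))"
    "periodic (sched_period (solve I)) (sched_tour (solve I)) (sched_visits (solve I))"
    "avg_length (sched_period (solve I)) (sched_tour (solve I)) \<le> 2 * OPT"
    unfolding per by (rule *; simp add: day N)+
qed

theorem theorem3:
  shows "\<exists>(P :: prog) (p :: nat poly). \<forall>I. tree_input I \<longrightarrow>
    (\<exists>S t. runs P (enc_input I) (enc_schedule S) t \<and>
       t \<le> poly p (size (enc_input I)) \<and>
       rftt.feasible (in_graph I) 0 (in_turnover I) (sched_tour S) (sched_visits S) \<and>
       rftt.periodic (sched_period S) (sched_tour S) (sched_visits S) \<and>
       rftt.avg_length (in_weight I) (sched_period S) (sched_tour S)
         \<le> 2 * rftt.OPT (in_graph I) 0 (in_weight I) (in_turnover I))"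
proof (rule exI[of _ sched_prog], rule exI[of _ "600 * (12 * [:2, 1:] ^ 3) ^ 5"], intro allI impI)
  fix I assume I: "tree_input I"
  interpret rftt_tree "in_graph I" 0 "in_weight I" "in_turnover I"
    using I by (simp add: tree_input_def)
  have "u \<le> length (snd I) \<and> v \<le> length (snd I)" if "(u, v, w) \<in> set (fst I)" for u v w
  proof -
    have "(u, v) \<in> parcs (in_graph I)" using that by (force simp: in_graph_def)
    from in_arcsD1[OF this] in_arcsD2[OF this] show ?thesis by (simp add: in_graph_def)
  qed
  then have "\<forall>(u, v, w)\<in>set (fst I). u \<le> length (snd I) \<and> v \<le> length (snd I)"
    by blast
  from runs_solve[OF this] obtain t where t: "runs sched_prog (enc_input I) (enc_schedule (solve I)) t"
    "t \<le> 600 * (12 * (size (enc_input I) + 2) ^ 3) ^ 5"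
    by blast
  \<comment> \<open>\<open>[:2, 1:]\<close> is the polynomial \<open>x + 2\<close>, so the time
    bound of \<open>runs_solve\<close> is a polynomial evaluated at the input size.\<close>
  have "poly (600 * (12 * [:2, 1:] ^ 3) ^ 5) x = 600 * (12 * (x + 2) ^ 3) ^ 5" for x :: nat
    by (simp add: poly_power poly_mult add.commute del: power_mult_distrib)
  with t solve_correct[OF I] show "\<exists>S t. runs sched_prog (enc_input I) (enc_schedule S) t \<and>
       t \<le> poly (600 * (12 * [:2, 1:] ^ 3) ^ 5) (size (enc_input I)) \<and>
       rftt.feasible (in_graph I) 0 (in_turnover I) (sched_tour S) (sched_visits S) \<and>
       rftt.periodic (sched_period S) (sched_tour S) (sched_visits S) \<and>
       rftt.avg_length (in_weight I) (sched_period S) (sched_tour S)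
         \<le> 2 * rftt.OPT (in_graph I) 0 (in_weight I) (in_turnover I)"
    by metis
qed

end
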